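(* For every $h\in\mathrm{ENH}_n$ one has $\mathbf d_N(h)=[\mathbb d_N,h]$ as elements of $\mathbb{E}\mathrm{NH}_n$, where $[\cdot,\cdot]$ is the supercommutator.
   Context: $\Bbbk$ is a field of characteristic $0$; $n\ge1$, $N\ge0$ integers. $\mathrm{Pol}_n=\Bbbk[X_1,\dots,X_n]$ and $\mathrm{EPol}_n=\mathrm{Pol}_n\otimes\bigwedge^\bullet(\omega_1,\dots,\omega_n)$. The symmetric group acts on $\mathrm{EPol}_n$ by algebra automorphisms: $s_r$ swaps $X_r,X_{r+1}$ and fixes the other $X_i$, $s_r(\omega_r)=\omega_r+(X_r-X_{r+1})\omega_{r+1}$, $s_r(\omega_i)=\omega_i$ for $i\ne r$; $\partial_r=\frac{1-s_r}{X_r-X_{r+1}}$. $\mathbb{E}\mathrm{NH}_n\subset\mathrm{End}_\Bbbk(\mathrm{EPol}_n)$ is the subalgebra generated by: left multiplications by $X_i$; $\omega_i^+$ = left multiplication by $\omega_i$; the annihilation operators $\omega_i^-$ with $\omega_i^-(Q)=0$, $\omega_i^-(\omega_iQ)=Q$ for all $Q=P\omega_{i_1}\cdots\omega_{i_k}$, $P\in\mathrm{Pol}_n$, with distinct $i_1,\dots,i_k\neq i$ ($1\le i\le n$); and $T_r=\partial_r$ ($1\le r\le n-1$). $\mathrm{ENH}_n$ is the subalgebra generated by the $X_i$, $\omega_i=\omega_i^+$, $T_r$. View $\mathbb{E}\mathrm{NH}_n$ as a superalgebra with $X_i,T_r$ even and $\omega_i^\pm$ odd. Grade $\mathrm{ENH}_n$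 by $\deg X_i=\deg T_r=0$, $\deg\omega_i=1$. $\mathbf d_N:\mathrm{ENH}_n\to\mathrm{ENH}_n$ is the unique linear operator with $\mathbf d_N(X_i)=0$, $\mathbf d_N(T_r)=0$, $\mathbf d_N(\omega_1)=X_1^N$ and $\mathbf d_N(PQ)=\mathbf d_N(P)Q+(-1)^{\deg P}P\,\mathbf d_N(Q)$ for homogeneous $P,Q\in\mathrm{ENH}_n$. Define $P_1=X_1^N$, $P_{r+1}=-\partial_r(P_r)$ for $1\le r\le n-1$, and $\mathbb d_N=\sum_{i=1}^nP_i\,\omega_i^-\in\mathbb{E}\mathrm{NH}_n$. *)

theory Defs
  imports
    "HOL-Library.Poly_Mapping"
    "HOL-Library.FuncSet"
    "HOL-Library.Z2"
    "HOL-Combinatorics.Transposition"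
begin

section \<open>Polynomials and extended polynomials\<close>

text \<open>
  Monomials are finitely supported exponent vectors. The algebra $\mathrm{Pol}_n$ consists of the
  polynomials in which only the variables $X_1,\dots,X_n$ occur. An element of $\mathrm{EPol}_n$
  is written in the $\mathrm{Pol}_n$-basis
  $\omega_I = \omega_{i_1}\cdots\omega_{i_k}$, where $I = \{i_1 < \dots < i_k\}$ runs over the
  subsets of $\{1,\dots,n\}$: the value at the key $I$ is the coefficient of $\omega_I$.
\<close>

type_synonym 'k pol = "(nat \<Rightarrow>\<^sub>0 nat) \<Rightarrow>\<^sub>0 'k"

type_synonym 'k epol = "nat set \<Rightarrow>\<^sub>0 'k pol"

definition Pol :: "nat \<Rightarrow> 'k::field_char_0 pol set" where
  "Pol n = {p. \<forall>m \<in> Poly_Mapping.keys p. Poly_Mapping.keys m \<subseteq> {1..n}}"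

definition EPol :: "nat \<Rightarrow> 'k::field_char_0 epol set" where
  "EPol n = {f. Poly_Mapping.keys f \<subseteq> Pow {1..n} \<and> (\<forall>I. Poly_Mapping.lookup f I \<in> Pol n)}"

definition pX :: "nat \<Rightarrow> 'k::field_char_0 pol" where
  "pX i = Poly_Mapping.single (Poly_Mapping.single i 1) 1"

text \<open>
  The structure constants of the exterior algebra:
  $\omega_I\,\omega_J = \mathit{wsign}(I,J)\,\omega_{I\cup J}$, the sign counting the inversions
  between \<open>I\<close> and \<open>J\<close>.
\<close>

definition wsign :: "nat set \<Rightarrow> nat set \<Rightarrow> 'k::field_char_0 pol" where
  "wsign I J = (if I \<inter> J = {} then (- 1) ^ card {(i, j) \<in> I \<times> J. j < i} else 0)"

definition emult :: "'k::field_char_0 epol \<Rightarrow> 'k epol \<Rightarrow> 'k epol" (infixl "\<star>" 70) where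
  "f \<star> g = (\<Sum>I\<in>Poly_Mapping.keys f. \<Sum>J\<in>Poly_Mapping.keys g.
     Poly_Mapping.single (I \<union> J)
       (wsign I J * Poly_Mapping.lookup f I * Poly_Mapping.lookup g J))"

definition emb :: "'k::field_char_0 pol \<Rightarrow> 'k epol" where
  "emb p = Poly_Mapping.single {} p"

definition escale :: "'k::field_char_0 \<Rightarrow> 'k epol \<Rightarrow> 'k epol" where
  "escale c f = emb (Poly_Mapping.single 0 c) \<star> f"

definition eX :: "nat \<Rightarrow> 'k::field_char_0 epol" where
  "eX i = emb (pX i)"

definition eW :: "nat \<Rightarrow> 'k::field_char_0 epol" where
  "eW i = Poly_Mapping.single {i} 1"


section \<open>The action of the symmetric group and the Demazure operators\<close>

text \<open>
  The exchange of $X_r$ and $X_{r+1}$ is realised by pulling back coefficients along the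
  permutation of exponent vectors, which is an involution.
\<close>

definition swap_pol :: "nat \<Rightarrow> 'k::field_char_0 pol \<Rightarrow> 'k pol" where
  "swap_pol r = Poly_Mapping.map_key (Poly_Mapping.map_key (transpose r (Suc r)))"

definition swap_eW :: "nat \<Rightarrow> nat \<Rightarrow> 'k::field_char_0 epol" where
  "swap_eW r i = (if i = r then eW r + (eX r - eX (Suc r)) \<star> eW (Suc r) else eW i)"

text \<open>
  The algebra automorphism $s_r$, given by its values on the generators:
  $s_r(p\,\omega_{i_1}\cdots\omega_{i_k}) = s_r(p)\,s_r(\omega_{i_1})\cdots s_r(\omega_{i_k})$
  for $i_1 < \dots < i_k$, extended additively.
\<close>

definition swap_epol :: "nat \<Rightarrow> 'k::field_char_0 epol \<Rightarrow> 'k epol" where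
  "swap_epol r f = (\<Sum>I\<in>Poly_Mapping.keys f.
     emb (swap_pol r (Poly_Mapping.lookup f I)) \<star>
       foldr (\<star>) (map (swap_eW r) (sorted_list_of_set I)) (emb 1))"

text \<open>The values of $s_r$ on polynomials and on the $\omega_i$ are the intended ones.\<close>

lemma inj_transposition: "inj (transpose a b)"
  by (rule inj_on_inverseI[where g = "transpose a b"]) simp

lemma inj_map_key_transpose:
  "inj (Poly_Mapping.map_key (transpose a b) :: (nat \<Rightarrow>\<^sub>0 nat) \<Rightarrow> _)"
  by (rule inj_on_inverseI[where g = "Poly_Mapping.map_key (transpose a b)"])
     (simp add: map_key_compose[OF inj_transposition inj_transposition] map_key_id comp_def)

lemma swap_pol_zero: "swap_pol r 0 = 0"
  by (simp add: swap_pol_def map_key_zero[OF inj_map_key_transpose])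

lemma swap_pol_one: "swap_pol r (1 :: 'k::field_char_0 pol) = 1"
  using map_key_single[OF inj_map_key_transpose, of r "Suc r" 0 "1 :: 'k"]
  unfolding swap_pol_def map_key_zero[OF inj_transposition] single_one .

lemma swap_pol_pX: "swap_pol r (pX i :: 'k::field_char_0 pol) = pX (transpose r (Suc r) i)"
proof -
  let ?t = "transpose r (Suc r)"
  have *: "Poly_Mapping.map_key ?t (Poly_Mapping.single (?t i) (1::nat)) = Poly_Mapping.single i 1"
    by (rule map_key_single[OF inj_transposition])
  show ?thesis
    using map_key_single[OF inj_map_key_transpose, of r "Suc r" "Poly_Mapping.single (?t i) 1" "1 :: 'k"]
    unfolding * swap_pol_def pX_def .
qed

lemma sum_single_lookup:
  "(\<Sum>I\<in>Poly_Mapping.keys f. Poly_Mapping.single I (Poly_Mapping.lookup f I)) = f"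
  by (rule poly_mapping_eqI) (simp add: lookup_sum lookup_single when_def in_keys_iff)

lemma emult_one_right: "f \<star> emb 1 = f"
  by (simp add: emult_def emb_def wsign_def sum_single_lookup)

lemma emult_one_left: "emb 1 \<star> f = f"
  by (simp add: emult_def emb_def wsign_def sum_single_lookup)

lemma swap_epol_eW: "swap_epol r (eW i) = swap_eW r i"
  by (simp add: swap_epol_def eW_def emult_one_left emult_one_right swap_pol_one)

lemma swap_epol_emb: "swap_epol r (emb p) = emb (swap_pol r p)"
  by (cases "p = 0")
     (simp_all add: swap_epol_def emb_def emult_one_right[unfolded emb_def] swap_pol_zero)

text \<open>
  The quotient $(f - s_r f)/(X_r - X_{r+1})$, which is unique because $\mathrm{EPol}_n$ is a free
  module over the domain $\mathrm{Pol}_n$.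
\<close>

definition demazure :: "nat \<Rightarrow> nat \<Rightarrow> 'k::field_char_0 epol \<Rightarrow> 'k epol" where
  "demazure n r f = (THE g. g \<in> EPol n \<and> (eX r - eX (Suc r)) \<star> g = f - swap_epol r f)"

text \<open>
  Annihilation: for \<open>i \<in> I\<close> one has $\omega_I = \pm\,\omega_i\,\omega_{I\setminus\{i\}}$ with the
  sign \<open>wsign {i} (I - {i})\<close>, so $\omega_I$ is sent to $\pm\,\omega_{I\setminus\{i\}}$; the other
  $\omega_I$ are sent to $0$. See \<open>annih_creation\<close> and \<open>annih_zero\<close> below.
\<close>

definition annih :: "nat \<Rightarrow> 'k::field_char_0 epol \<Rightarrow> 'k epol" where
  "annih i f = (\<Sum>I\<in>{I \<in> Poly_Mapping.keys f. i \<in> I}.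
     Poly_Mapping.single (I - {i}) (wsign {i} (I - {i}) * Poly_Mapping.lookup f I))"

lemma emult_single:
  "Poly_Mapping.single I p \<star> Poly_Mapping.single J q =
     Poly_Mapping.single (I \<union> J) (wsign I J * p * q)"
  by (cases "p = 0"; cases "q = 0") (simp_all add: emult_def)

lemma annih_zero: "i \<notin> J \<Longrightarrow> annih i (Poly_Mapping.single J p) = 0"
  unfolding annih_def by (rule sum.neutral) (auto split: if_splits)

lemma wsign_square: "I \<inter> J = {} \<Longrightarrow> wsign I J * wsign I J = 1"
  by (simp add: wsign_def flip: power_mult_distrib)

lemma annih_creation:
  fixes p :: "'k::field_char_0 pol"
  assumes "i \<notin> J"
  shows "annih i (eW i \<star> Poly_Mapping.single J p) = Poly_Mapping.single J p"
proof (cases "p = 0")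
  case True
  then show ?thesis by (simp add: annih_def emult_def)
next
  case False
  have sq: "wsign {i} J * (wsign {i} J * p) = p"
    using wsign_square[of "{i}" J, where 'a = 'k] assms by (simp flip: mult.assoc)
  with False have nz: "wsign {i} J * p \<noteq> 0" by auto
  have "insert i J - {i} = J" using assms by auto
  moreover have "{I. I = insert i J \<and> i \<in> I} = {insert i J}" by auto
  ultimately show ?thesis
    using nz by (simp add: eW_def emult_single annih_def sq)
qed

lemma wsign_singletons: "wsign {i} {j} = (if i = j then 0 else if j < i then - 1 else 1)"
proof -
  have "{(a, b) \<in> {i} \<times> {j}. b < a} = (if j < i then {(i, j)} else {})"
    by auto
  then show ?thesis
    unfolding wsign_def by simp
qed

lemma emult_eW_eW: "eW i \<star> eW j = - (eW j \<star> eW i)"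
  by (cases i j rule: linorder_cases)
     (simp_all add: eW_def emult_single wsign_singletons insert_commute single_uminus)


section \<open>The algebra of operators on extended polynomials\<close>

text \<open>
  Elements of $\mathrm{End}_\Bbbk(\mathrm{EPol}_n)$ are functions that are \<open>undefined\<close> outside
  \<open>EPol n\<close>, so that equality of operators is equality on \<open>EPol n\<close>. Their product is
  \<open>compose (EPol n)\<close>.
\<close>

type_synonym 'k eop = "'k epol \<Rightarrow> 'k epol"

definition ozero :: "nat \<Rightarrow> 'k::field_char_0 eop" where
  "ozero n = (\<lambda>f\<in>EPol n. 0)"

definition oone :: "nat \<Rightarrow> 'k::field_char_0 eop" where
  "oone n = (\<lambda>f\<in>EPol n. f)"

definition oadd :: "nat \<Rightarrow> 'k::field_char_0 eop \<Rightarrow> 'k eop \<Rightarrow> 'k eop" where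
  "oadd n A B = (\<lambda>f\<in>EPol n. A f + B f)"

definition oscale :: "nat \<Rightarrow> 'k::field_char_0 \<Rightarrow> 'k eop \<Rightarrow> 'k eop" where
  "oscale n c A = (\<lambda>f\<in>EPol n. escale c (A f))"

definition osum :: "nat \<Rightarrow> ('i \<Rightarrow> 'k::field_char_0 eop) \<Rightarrow> 'i set \<Rightarrow> 'k eop" where
  "osum n A S = (\<lambda>f\<in>EPol n. \<Sum>i\<in>S. A i f)"

abbreviation omult :: "nat \<Rightarrow> 'k::field_char_0 eop \<Rightarrow> 'k eop \<Rightarrow> 'k eop" where
  "omult n \<equiv> compose (EPol n)"

definition lmul :: "nat \<Rightarrow> 'k::field_char_0 epol \<Rightarrow> 'k eop" where
  "lmul n a = (\<lambda>f\<in>EPol n. a \<star> f)"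

definition opX :: "nat \<Rightarrow> nat \<Rightarrow> 'k::field_char_0 eop" where
  "opX n i = lmul n (eX i)"

definition opWp :: "nat \<Rightarrow> nat \<Rightarrow> 'k::field_char_0 eop" where
  "opWp n i = lmul n (eW i)"

definition opWm :: "nat \<Rightarrow> nat \<Rightarrow> 'k::field_char_0 eop" where
  "opWm n i = (\<lambda>f\<in>EPol n. annih i f)"

definition opT :: "nat \<Rightarrow> nat \<Rightarrow> 'k::field_char_0 eop" where
  "opT n r = (\<lambda>f\<in>EPol n. demazure n r f)"

inductive_set generated_subalgebra :: "nat \<Rightarrow> 'k::field_char_0 eop set \<Rightarrow> 'k eop set"
  for n :: nat and G :: "'k eop set" where
  gen: "A \<in> G \<Longrightarrow> A \<in> generated_subalgebra n G"
| one: "oone n \<in> generated_subalgebra n G"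
| scale: "A \<in> generated_subalgebra n G \<Longrightarrow> oscale n c A \<in> generated_subalgebra n G"
| add: "A \<in> generated_subalgebra n G \<Longrightarrow> B \<in> generated_subalgebra n G \<Longrightarrow>
    oadd n A B \<in> generated_subalgebra n G"
| mult: "A \<in> generated_subalgebra n G \<Longrightarrow> B \<in> generated_subalgebra n G \<Longrightarrow>
    omult n A B \<in> generated_subalgebra n G"

text \<open>
  The grading of \<open>generated_subalgebra n (fst ` D)\<close> in which the generator \<open>A\<close> has degree \<open>d\<close>
  whenever \<open>(A, d) \<in> D\<close>: the component of degree \<open>d\<close> is spanned by the products of generators of
  total degree \<open>d\<close>. It is used with degrees in \<open>nat\<close> for a grading by natural numbers, and with
  degrees in \<open>bit\<close>, the integers modulo \<open>2\<close>, for a superalgebra structure.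
\<close>

inductive homogeneous ::
  "nat \<Rightarrow> ('k::field_char_0 eop \<times> 'd::comm_monoid_add) set \<Rightarrow> 'd \<Rightarrow> 'k eop \<Rightarrow> bool"
  for n :: nat and D :: "('k eop \<times> 'd) set" where
  gen: "(A, d) \<in> D \<Longrightarrow> homogeneous n D d A"
| one: "homogeneous n D 0 (oone n)"
| zero: "homogeneous n D d (ozero n)"
| scale: "homogeneous n D d A \<Longrightarrow> homogeneous n D d (oscale n c A)"
| add: "homogeneous n D d A \<Longrightarrow> homogeneous n D d B \<Longrightarrow> homogeneous n D d (oadd n A B)"
| mult: "homogeneous n D d A \<Longrightarrow> homogeneous n D e B \<Longrightarrow>
    homogeneous n D (d + e) (omult n A B)"

definition graded_component ::
  "nat \<Rightarrow> ('k::field_char_0 eop \<times> 'd::comm_monoid_add) set \<Rightarrow> 'd \<Rightarrow> 'k eop set" where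
  "graded_component n D d = {A. homogeneous n D d A}"


section \<open>Extended nilHecke algebras\<close>

definition ENH_gens :: "nat \<Rightarrow> ('k::field_char_0 eop \<times> nat) set" where
  "ENH_gens n = {(opX n i, 0) | i. i \<in> {1..n}} \<union> {(opWp n i, 1) | i. i \<in> {1..n}}
     \<union> {(opT n r, 0) | r. r \<in> {1..<n}}"

definition ENH :: "nat \<Rightarrow> 'k::field_char_0 eop set" where
  "ENH n = generated_subalgebra n (fst ` ENH_gens n)"

definition ENH_deg :: "nat \<Rightarrow> nat \<Rightarrow> 'k::field_char_0 eop set" where
  "ENH_deg n = graded_component n (ENH_gens n)"

definition EENH_gens :: "nat \<Rightarrow> ('k::field_char_0 eop \<times> bit) set" where
  "EENH_gens n = {(opX n i, 0) | i. i \<in> {1..n}} \<union> {(opWp n i, 1) | i. i \<in> {1..n}}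
     \<union> {(opWm n i, 1) | i. i \<in> {1..n}} \<union> {(opT n r, 0) | r. r \<in> {1..<n}}"

definition EENH :: "nat \<Rightarrow> 'k::field_char_0 eop set" where
  "EENH n = generated_subalgebra n (fst ` EENH_gens n)"

lemma ENH_subset_EENH: "(ENH n :: 'k::field_char_0 eop set) \<subseteq> EENH n"
proof
  fix A :: "'k eop"
  assume "A \<in> ENH n"
  then show "A \<in> EENH n"
    unfolding ENH_def EENH_def
  proof induction
    case (gen A)
    then have "A \<in> fst ` EENH_gens n"
      unfolding ENH_gens_def EENH_gens_def image_Un by (auto simp: image_iff)
    then show ?case by (rule generated_subalgebra.gen)
  qed (rule generated_subalgebra.intros; assumption)+
qed

definition EENH_parity :: "nat \<Rightarrow> bit \<Rightarrow> 'k::field_char_0 eop set" where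
  "EENH_parity n = graded_component n (EENH_gens n)"

definition EENH_parts :: "nat \<Rightarrow> 'k::field_char_0 eop \<Rightarrow> bit \<Rightarrow> 'k eop" where
  "EENH_parts n A = (THE c. (\<forall>p. c p \<in> EENH_parity n p) \<and> A = oadd n (c 0) (c 1))"

text \<open>
  The supercommutator is the bilinear extension of
  $[A,B] = AB - (-1)^{|A||B|}BA$ for homogeneous $A$, $B$.
\<close>

definition supercommutator ::
    "nat \<Rightarrow> 'k::field_char_0 eop \<Rightarrow> 'k eop \<Rightarrow> 'k eop" where
  "supercommutator n A B =
     osum n (\<lambda>(p, q). oadd n (omult n (EENH_parts n A p) (EENH_parts n B q))
         (oscale n (- (if p * q = 1 then - 1 else 1))
           (omult n (EENH_parts n B q) (EENH_parts n A p))))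
       (UNIV :: (bit \<times> bit) set)"


section \<open>The differentials\<close>

text \<open>
  Being \<open>extensional\<close> makes \<open>d\<close> a map defined on \<open>ENH n\<close> only, as uniqueness requires.
\<close>

definition is_ENH_differential ::
    "nat \<Rightarrow> nat \<Rightarrow> ('k::field_char_0 eop \<Rightarrow> 'k eop) \<Rightarrow> bool" where
  "is_ENH_differential n N d \<longleftrightarrow>
     d \<in> ENH n \<rightarrow>\<^sub>E ENH n \<and>
     (\<forall>A\<in>ENH n. \<forall>B\<in>ENH n. d (oadd n A B) = oadd n (d A) (d B)) \<and>
     (\<forall>c. \<forall>A\<in>ENH n. d (oscale n c A) = oscale n c (d A)) \<and>
     (\<forall>i\<in>{1..n}. d (opX n i) = ozero n) \<and>
     (\<forall>r\<in>{1..<n}. d (opT n r) = ozero n) \<and>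
     d (opWp n 1) = lmul n (emb (pX 1 ^ N)) \<and>
     (\<forall>k l. \<forall>A\<in>ENH_deg n k. \<forall>B\<in>ENH_deg n l.
        d (omult n A B) = oadd n (omult n (d A) B) (oscale n ((- 1) ^ k) (omult n A (d B))))"

definition dN :: "nat \<Rightarrow> nat \<Rightarrow> 'k::field_char_0 eop \<Rightarrow> 'k eop" where
  "dN n N = (THE d. is_ENH_differential n N d)"

text \<open>The sequence starts at index \<open>1\<close>; the value at \<open>0\<close> is a dummy.\<close>

fun Pseq :: "nat \<Rightarrow> nat \<Rightarrow> nat \<Rightarrow> 'k::field_char_0 epol" where
  "Pseq n N 0 = 0"
| "Pseq n N (Suc 0) = emb (pX 1 ^ N)"
| "Pseq n N (Suc (Suc r)) = - demazure n (Suc r) (Pseq n N (Suc r))"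

definition ddN :: "nat \<Rightarrow> nat \<Rightarrow> 'k::field_char_0 eop" where
  "ddN n N = osum n (\<lambda>i. omult n (lmul n (Pseq n N i)) (opWm n i)) {1..n}"

end

theory Submission
  imports Defs "HOL.Modules"
begin

text \<open>
  The operator $\mathbb d_N = \sum_i P_i\,\omega_i^-$ is an odd derivation of $\mathrm{EPol}_n$
  sending $\omega_i$ to $P_i$ and killing $\mathrm{Pol}_n$. It commutes with every $s_r$: this is
  checked on the $\omega_i$, where $i = r$ is the recursion defining $P_{r+1}$ and $i \neq r$ says
  that $s_r P_i = P_i$. Hence it commutes with every $\partial_r$, so that $h \mapsto [\mathbb d_N, h]$
  kills $X_i$ and $T_r$ and sends $\omega_i$ to $P_i$; it therefore preserves $\mathrm{ENH}_n$ and
  has all the properties characterising $\mathbf d_N$. These properties determine an operator, as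
  $\omega_{r+1}$ is a polynomial in $\omega_r$, $T_r$, $X_r$ and $X_{r+1}$.

  Writing $\varepsilon$ for the parity involution of $\mathrm{EPol}_n$, the supercommutator is
  $[\mathbb d_N, h] = \mathbb d_N h - \varepsilon h \varepsilon\,\mathbb d_N$ for all $h$, homogeneous
  or not.
\<close>

section \<open>Polynomials\<close>

text \<open>Three objects are definite descriptions, and each is opened by its own uniqueness
  argument: \<open>demazure\<close> by cancelling X_r - X_(r+1), a nonzero element of a domain;
  \<open>EENH_parts\<close> by conjugation with \<epsilon>, which acts as 1 on even and as -1 on odd
  operators, together with the cancellation of 2; \<open>dN\<close> by the generators. The delicate
  point is s_r P_i = P_i for r = i - 2, since s_(i-2) does not commute with the s_(i-1) of the last
  step of the recursion: two steps have to be unfolded together and the result read as an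
  alternating polynomial over a Vandermonde product. Most other identities are checked on
  generators, so the product of extended polynomials enters mainly through left multiplication by
  polynomials, by the \<omega>_i and by their images under s_r.\<close>

lemma Pol_const [simp]: "Poly_Mapping.single 0 c \<in> Pol n"
  by (simp add: Pol_def)

lemma Pol_zero [simp]: "0 \<in> Pol n"
  by (simp add: Pol_def)

lemma Pol_one [simp]: "1 \<in> Pol n"
  using Pol_const[of 1 n] by simp

lemma Pol_pX [simp]: "i \<in> {1..n} \<Longrightarrow> pX i \<in> Pol n"
  by (simp add: Pol_def pX_def)

lemma Pol_add [simp]: "p \<in> Pol n \<Longrightarrow> q \<in> Pol n \<Longrightarrow> p + q \<in> Pol n"
  unfolding Pol_def using Poly_Mapping.keys_add[of p q] by blast

lemma Pol_uminus [simp]: "p \<in> Pol n \<Longrightarrow> - p \<in> Pol n"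
  by (simp add: Pol_def keys_def)

lemma Pol_diff [simp]: "p \<in> Pol n \<Longrightarrow> q \<in> Pol n \<Longrightarrow> p - q \<in> Pol n"
  using Pol_add[OF _ Pol_uminus, of p n q] by simp

lemma Pol_mult [simp]:
  assumes "p \<in> Pol n" and "q \<in> Pol n"
  shows "p * q \<in> Pol n"
  unfolding Pol_def
proof (intro CollectI ballI)
  fix m
  assume "m \<in> Poly_Mapping.keys (p * q)"
  then obtain a b where "m = a + b" "a \<in> Poly_Mapping.keys p" "b \<in> Poly_Mapping.keys q"
    using keys_mult[of p q] by blast
  with assms show "Poly_Mapping.keys m \<subseteq> {1..n}"
    using Poly_Mapping.keys_add[of a b] unfolding Pol_def by blast
qed

lemma Pol_power [simp]: "p \<in> Pol n \<Longrightarrow> p ^ k \<in> Pol n"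
  by (induction k) simp_all

lemma pX_power: "pX i ^ e = Poly_Mapping.single (Poly_Mapping.single i e) 1"
proof (induction e)
  case (Suc e)
  show ?case
    unfolding power_Suc Suc.IH
    by (simp add: pX_def mult_single flip: single_add)
qed simp

lemma single_sum_pX:
  "finite S \<Longrightarrow> Poly_Mapping.single (\<Sum>i\<in>S. Poly_Mapping.single i (e i)) (1 :: 'k::field_char_0) = (\<Prod>i\<in>S. pX i ^ e i)"
proof (induction S rule: finite_induct)
  case (insert i S)
  have "Poly_Mapping.single (\<Sum>i\<in>insert i S. Poly_Mapping.single i (e i)) (1 :: 'k) =
      Poly_Mapping.single (Poly_Mapping.single i (e i)) 1 *
        Poly_Mapping.single (\<Sum>i\<in>S. Poly_Mapping.single i (e i)) 1"
    using insert(1,2) by (simp add: mult_single)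
  also have "\<dots> = pX i ^ e i * (\<Prod>i\<in>S. pX i ^ e i)"
    by (simp only: pX_power insert(3))
  also have "\<dots> = (\<Prod>i\<in>insert i S. pX i ^ e i)"
    using insert(1,2) by simp
  finally show ?case .
qed simp

lemma monomial_eq_prod_pX:
  "Poly_Mapping.single m c =
     Poly_Mapping.single 0 c * (\<Prod>i\<in>Poly_Mapping.keys m. pX i ^ Poly_Mapping.lookup m i)"
proof -
  have "(\<Prod>i\<in>Poly_Mapping.keys m. pX i ^ Poly_Mapping.lookup m i)
      = (Poly_Mapping.single m 1 :: 'a pol)"
    using single_sum_pX[of "Poly_Mapping.keys m" "Poly_Mapping.lookup m", where 'k = 'a]
    by (simp add: sum_single_lookup)
  then show ?thesis
    by (simp add: mult_single)
qed

text \<open>Induction over \<open>Pol n\<close> as an algebra. The transpositions and the quotients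
  by X_r - X_(r+1) are governed by their behaviour on variables, sums and products.\<close>

lemma Pol_induct [consumes 1, case_names const var add mult]:
  fixes p :: "'k::field_char_0 pol"
  assumes p: "p \<in> Pol n"
    and const: "\<And>c. P (Poly_Mapping.single 0 c)"
    and var: "\<And>i. i \<in> {1..n} \<Longrightarrow> P (pX i)"
    and add: "\<And>p q. p \<in> Pol n \<Longrightarrow> q \<in> Pol n \<Longrightarrow> P p \<Longrightarrow> P q \<Longrightarrow> P (p + q)"
    and mult: "\<And>p q. p \<in> Pol n \<Longrightarrow> q \<in> Pol n \<Longrightarrow> P p \<Longrightarrow> P q \<Longrightarrow> P (p * q)"
  shows "P p"
proof -
  \<comment> \<open>The cases \<open>add\<close> and \<open>mult\<close> demand membership in
    \<open>Pol n\<close>, so it is carried along.\<close>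
  define Q where "Q p \<longleftrightarrow> p \<in> Pol n \<and> P p" for p
  have Qc: "Q (Poly_Mapping.single 0 c)" for c
    by (simp add: Q_def const)
  have Q0: "Q 0" and Q1: "Q 1"
    using Qc[of 0] Qc[of 1] by simp_all
  have Qm: "Q p \<Longrightarrow> Q q \<Longrightarrow> Q (p * q)" for p q
    by (simp add: Q_def mult)
  have Qpow: "Q (pX i ^ e)" if "i \<in> {1..n}" for i e
  proof (induction e)
    case (Suc e)
    have "Q (pX i)"
      using that by (simp add: Q_def var)
    with Suc show ?case
      by (simp add: Qm)
  qed (simp add: Q1)
  have Qprod: "finite S \<Longrightarrow> S \<subseteq> {1..n} \<Longrightarrow> Q (\<Prod>i\<in>S. pX i ^ e i)" for S e
    by (induction S rule: finite_induct) (auto intro!: Q1 Qm Qpow)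
  have Qsum: "finite M \<Longrightarrow> (\<And>m. m \<in> M \<Longrightarrow> Q (f m)) \<Longrightarrow> Q (\<Sum>m\<in>M. f m)"
    for M :: "(nat \<Rightarrow>\<^sub>0 nat) set" and f
    by (induction M rule: finite_induct) (use Q0 in \<open>auto simp: Q_def add\<close>)
  have "Q (\<Sum>m\<in>Poly_Mapping.keys p. Poly_Mapping.single m (Poly_Mapping.lookup p m))"
  proof (rule Qsum)
    fix m
    assume "m \<in> Poly_Mapping.keys p"
    with p have "Poly_Mapping.keys m \<subseteq> {1..n}"
      by (auto simp: Pol_def)
    then show "Q (Poly_Mapping.single m (Poly_Mapping.lookup p m))"
      by (subst monomial_eq_prod_pX) (intro Qm Qc Qprod finite_keys)
  qed simp
  then show ?thesis
    by (simp add: sum_single_lookup Q_def)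
qed

section \<open>The transpositions acting on polynomials\<close>

lemma swap_pol_add: "swap_pol r (p + q) = swap_pol r p + swap_pol r q"
  by (simp add: swap_pol_def map_key_plus[OF inj_map_key_transpose])

text \<open>Coefficients are pulled back, so the exponent vector moves by the inverse permutation; a
  transposition is its own inverse.\<close>

lemma swap_pol_single:
  "swap_pol r (Poly_Mapping.single m c) =
     Poly_Mapping.single (Poly_Mapping.map_key (transpose r (Suc r)) m) c"
proof -
  let ?t = "Poly_Mapping.map_key (transpose r (Suc r)) :: (nat \<Rightarrow>\<^sub>0 nat) \<Rightarrow> _"
  have "?t (?t m) = m"
    by (simp add: map_key_compose[OF inj_transposition inj_transposition] map_key_id comp_def)
  then show ?thesis
    unfolding swap_pol_def by (metis map_key_single[OF inj_map_key_transpose])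
qed

lemma swap_pol_const: "swap_pol r (Poly_Mapping.single 0 c) = Poly_Mapping.single 0 c"
  by (simp add: swap_pol_single map_key_zero[OF inj_transposition])

lemma swap_pol_uminus: "swap_pol r (- p) = - swap_pol r p"
  using swap_pol_add[of r p "- p"] by (simp add: swap_pol_zero eq_neg_iff_add_eq_0 add.commute)

lemma swap_pol_diff: "swap_pol r (p - q) = swap_pol r p - swap_pol r q"
  using swap_pol_add[of r p "- q"] by (simp add: swap_pol_uminus)

lemma swap_pol_sum: "swap_pol r (\<Sum>x\<in>S. f x) = (\<Sum>x\<in>S. swap_pol r (f x))"
  by (induction S rule: infinite_finite_induct) (simp_all add: swap_pol_zero swap_pol_add)

text \<open>By bilinearity this comes down to monomials, where it is the additivity of the
  permutation of exponent vectors.\<close>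

lemma swap_pol_mult: "swap_pol r (p * q) = swap_pol r p * swap_pol r q"
proof -
  have mono: "swap_pol r (Poly_Mapping.single a b * Poly_Mapping.single c d) =
      swap_pol r (Poly_Mapping.single a b) * swap_pol r (Poly_Mapping.single c d)"
    for a b c and d :: 'a
    by (simp add: mult_single swap_pol_single map_key_plus[OF inj_transposition])
  let ?s = "\<lambda>p. \<Sum>m\<in>Poly_Mapping.keys p. Poly_Mapping.single m (Poly_Mapping.lookup p m)"
  have "swap_pol r (?s p * ?s q) = swap_pol r (?s p) * swap_pol r (?s q)"
    by (simp only: sum_product swap_pol_sum mono)
  then show ?thesis
    by (simp only: sum_single_lookup)
qed

lemma swap_pol_power: "swap_pol r (p ^ k) = swap_pol r p ^ k"
  by (induction k) (simp_all add: swap_pol_one swap_pol_mult)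

lemma Pol_swap_pol [simp]:
  assumes "r \<in> {1..<n}" and "p \<in> Pol n"
  shows "swap_pol r p \<in> Pol n"
  using assms(2)
proof (induction rule: Pol_induct)
  case (var i)
  then show ?case
    using assms(1) by (auto simp: swap_pol_pX transpose_def)
qed (simp_all add: swap_pol_const swap_pol_add swap_pol_mult)

lemma swap_pol_swap_pol: "swap_pol r (swap_pol r p) = p"
  unfolding swap_pol_def
  by (simp add: map_key_compose[OF inj_map_key_transpose inj_map_key_transpose]
      map_key_compose[OF inj_transposition inj_transposition] map_key_id comp_def)

text \<open>The Coxeter relations hold for the transpositions, hence for their pullbacks.\<close>

lemma swap_pol_comm:
  assumes "Suc i < r \<or> Suc r < i"
  shows "swap_pol r (swap_pol i p) = swap_pol i (swap_pol r p)"
proof -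
  have "transpose r (Suc r) (transpose i (Suc i) x) = transpose i (Suc i) (transpose r (Suc r) x)" for x
    using assms by (auto simp: transpose_def)
  then show ?thesis
    unfolding swap_pol_def
    by (simp add: map_key_compose[OF inj_map_key_transpose inj_map_key_transpose]
      map_key_compose[OF inj_transposition inj_transposition] comp_def)
qed

lemma swap_pol_braid:
  "swap_pol i (swap_pol (Suc i) (swap_pol i p)) =
     swap_pol (Suc i) (swap_pol i (swap_pol (Suc i) p))"
proof -
  let ?t = "\<lambda>r. transpose r (Suc r)"
  let ?m = "\<lambda>r. Poly_Mapping.map_key (?t r) :: (nat \<Rightarrow>\<^sub>0 nat) \<Rightarrow> _"
  have *: "?t i (?t (Suc i) (?t i x)) = ?t (Suc i) (?t i (?t (Suc i) x))" for x
    by (auto simp: transpose_def)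
  have "?m i (?m (Suc i) (?m i m)) = ?m (Suc i) (?m i (?m (Suc i) m))" for m
    by (rule poly_mapping_eqI) (simp add: map_key.rep_eq[OF inj_transposition] *)
  then have "swap_pol i (swap_pol (Suc i) (swap_pol i (\<Sum>m\<in>M. Poly_Mapping.single m (f m)))) =
      swap_pol (Suc i) (swap_pol i (swap_pol (Suc i) (\<Sum>m\<in>M. Poly_Mapping.single m (f m))))"
    for M and f :: "_ \<Rightarrow> 'a"
    by (simp add: swap_pol_sum swap_pol_single)
  from this[of "Poly_Mapping.lookup p" "Poly_Mapping.keys p"] show ?thesis
    by (simp only: sum_single_lookup)
qed

lemma pX_inject: "pX i = (pX j :: 'k::field_char_0 pol) \<longleftrightarrow> i = j"
proof
  assume eq: "pX i = (pX j :: 'k pol)"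
  have "Poly_Mapping.keys (pX i :: 'k pol) = Poly_Mapping.keys (pX j :: 'k pol)"
    by (simp only: eq)
  then have "Poly_Mapping.keys (Poly_Mapping.single i (1::nat)) = Poly_Mapping.keys (Poly_Mapping.single j (1::nat))"
    by (simp add: pX_def)
  then show "i = j" by simp
qed simp

section \<open>Divided differences of polynomials\<close>

definition xdiff :: "nat \<Rightarrow> 'k::field_char_0 pol" where
  "xdiff r = pX r - pX (Suc r)"

lemma xdiff_nonzero: "xdiff r \<noteq> 0"
  by (simp add: xdiff_def pX_inject)

lemma xdiff_cancel: "xdiff r * p = xdiff r * q \<Longrightarrow> p = q"
  by (simp add: xdiff_nonzero)

lemma Pol_xdiff [simp]: "r \<in> {1..<n} \<Longrightarrow> xdiff r \<in> Pol n"
  by (simp add: xdiff_def)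

lemma swap_pol_xdiff: "swap_pol r (xdiff r) = - xdiff r"
  by (simp add: xdiff_def swap_pol_diff swap_pol_pX)

text \<open>The quotient obeys the twisted Leibniz rule D(p q) = D(p) q + s_r(p) D(q), so it exists
  for all polynomials once it exists for the variables.\<close>

lemma swap_pol_quotient:
  assumes r: "r \<in> {1..<n}" and "p \<in> Pol n"
  shows "\<exists>q\<in>Pol n. xdiff r * q = p - swap_pol r p"
  using assms(2)
proof (induction rule: Pol_induct)
  case (const c)
  then show ?case by (intro bexI[of _ 0]) (simp_all add: swap_pol_const)
next
  case (var i)
  \<comment> \<open>The quotients for X_r, X_(r+1) and the other variables are 1, -1 and 0.\<close>
  have "xdiff r * (if i = r then 1 else if i = Suc r then - 1 else 0) = pX i - swap_pol r (pX i)"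
    by (auto simp: xdiff_def swap_pol_pX transpose_def)
  then show ?case
    by (rule bexI) auto
next
  case (add p q)
  then obtain a b where "a \<in> Pol n" "b \<in> Pol n" "xdiff r * a = p - swap_pol r p"
      "xdiff r * b = q - swap_pol r q"
    by blast
  then show ?case
    by (intro bexI[of _ "a + b"]) (simp_all add: swap_pol_add ring_distribs)
next
  case (mult p q)
  then obtain a b where ab: "a \<in> Pol n" "b \<in> Pol n" "xdiff r * a = p - swap_pol r p"
      "xdiff r * b = q - swap_pol r q"
    by blast
  have "xdiff r * (a * q + swap_pol r p * b) = xdiff r * a * q + swap_pol r p * (xdiff r * b)"
    by (simp add: algebra_simps)
  also have "\<dots> = p * q - swap_pol r (p * q)"
    by (simp only: ab swap_pol_mult) (simp add: algebra_simps)
  finally show ?case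
    using ab mult r by (intro bexI[of _ "a * q + swap_pol r p * b"]) simp_all
qed

section \<open>Clifford relations\<close>

text \<open>The sign picked up when \<omega>_i moves to its place among the factors of \<omega>_J.
  Unlike \<open>wsign {i} J\<close> it is 1 or -1 also for i in J, hence always its own
  inverse.\<close>

definition sg :: "nat \<Rightarrow> nat set \<Rightarrow> 'k::field_char_0 pol" where
  "sg i J = (- 1) ^ card {j \<in> J. j < i}"

lemma wsign_empty [simp]: "wsign {} J = 1"
  by (simp add: wsign_def)

lemma wsign_singleton: "wsign {i} J = (if i \<in> J then 0 else sg i J)"
proof -
  have "{(a, b) \<in> {i} \<times> J. b < a} = Pair i ` {j \<in> J. j < i}"
    by auto
  then have "card {(a, b) \<in> {i} \<times> J. b < a} = card {j \<in> J. j < i}"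
    by (simp add: card_image inj_on_def)
  then show ?thesis
    by (simp add: wsign_def sg_def)
qed

lemma sg_insert: "j \<notin> J \<Longrightarrow> sg i (insert j J) = (if j < i then - sg i J else sg i J)"
proof -
  assume j: "j \<notin> J"
  have "finite {k \<in> J. k < i}"
    by (rule finite_subset[of _ "{..<i}"]) auto
  moreover have "{k \<in> insert j J. k < i} = (if j < i then insert j {k \<in> J. k < i} else {k \<in> J. k < i})"
    by auto
  ultimately show ?thesis
    using j by (simp add: sg_def)
qed

lemma sg_square [simp]:
  fixes p :: "'k::field_char_0 pol"
  shows "sg i J * sg i J = (1 :: 'k pol)" and "sg i J * (sg i J * p) = p"
proof -
  show "sg i J * sg i J = (1 :: 'k pol)"
    by (simp add: sg_def flip: power_mult_distrib)
  then show "sg i J * (sg i J * p) = p"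
    by (simp flip: mult.assoc)
qed

lemma Pol_sg [simp]: "sg i J \<in> Pol n"
  by (simp add: sg_def)

lemma swap_pol_sg [simp]: "swap_pol r (sg i J) = sg i J"
  by (simp add: sg_def swap_pol_power swap_pol_uminus swap_pol_one)

lemma lookup_emb_emult [simp]:
  "Poly_Mapping.lookup (emb p \<star> f) I = p * Poly_Mapping.lookup f I"
  by (cases "p = 0")
     (simp_all add: emult_def emb_def lookup_sum lookup_single when_def in_keys_iff)

lemma lookup_single_emult:
  "Poly_Mapping.lookup (Poly_Mapping.single {i} p \<star> f) I =
     (if i \<in> I then sg i (I - {i}) * p * Poly_Mapping.lookup f (I - {i}) else 0)"
proof (cases "p = 0")
  case False
  then have "Poly_Mapping.lookup (Poly_Mapping.single {i} p \<star> f) I =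
      (\<Sum>J\<in>Poly_Mapping.keys f. if insert i J = I then wsign {i} J * p * Poly_Mapping.lookup f J else 0)"
    by (simp add: emult_def lookup_sum lookup_single when_def)
  \<comment> \<open>A set J containing i contributes nothing because \<open>wsign\<close> vanishes
    there, which leaves J = I - {i}.\<close>
  also have "\<dots> = (\<Sum>J\<in>Poly_Mapping.keys f. if J = I - {i} then
      (if i \<in> I then sg i (I - {i}) * p * Poly_Mapping.lookup f (I - {i}) else 0) else 0)"
    by (rule sum.cong) (auto simp: wsign_singleton)
  also have "\<dots> = (if i \<in> I then sg i (I - {i}) * p * Poly_Mapping.lookup f (I - {i}) else 0)"
    by (simp add: in_keys_iff)
  finally show ?thesis .
qed (simp add: emult_def)

lemma lookup_eW_emult:
  "Poly_Mapping.lookup (eW i \<star> f) I =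
     (if i \<in> I then sg i (I - {i}) * Poly_Mapping.lookup f (I - {i}) else 0)"
  by (simp add: eW_def lookup_single_emult)

lemma lookup_annih:
  "Poly_Mapping.lookup (annih i f) I =
     (if i \<in> I then 0 else sg i I * Poly_Mapping.lookup f (insert i I))"
proof -
  have "Poly_Mapping.lookup (annih i f) I = (\<Sum>J\<in>{J \<in> Poly_Mapping.keys f. i \<in> J}.
      if J - {i} = I then wsign {i} (J - {i}) * Poly_Mapping.lookup f J else 0)"
    by (simp add: annih_def lookup_sum lookup_single when_def)
  also have "\<dots> = (\<Sum>J\<in>{J \<in> Poly_Mapping.keys f. i \<in> J}. if J = insert i I then
      (if i \<in> I then 0 else sg i I * Poly_Mapping.lookup f (insert i I)) else 0)"
    by (rule sum.cong) (auto simp: wsign_singleton insert_absorb)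
  also have "\<dots> = (if i \<in> I then 0 else sg i I * Poly_Mapping.lookup f (insert i I))"
    by (simp add: in_keys_iff)
  finally show ?thesis .
qed

text \<open>Left multiplications are treated as operators; the locale \<open>additive\<close> then
  supplies zero, negatives, differences and sums from additivity alone.\<close>

lemma additive_emb_emult: "additive (\<lambda>f. emb p \<star> f)"
  by unfold_locales (rule poly_mapping_eqI, simp add: lookup_add algebra_simps)

lemma additive_eW_emult: "additive (\<lambda>f. eW i \<star> f)"
  by unfold_locales (rule poly_mapping_eqI, simp add: lookup_eW_emult lookup_add algebra_simps)

lemma additive_annih: "additive (annih i)"
  by unfold_locales (rule poly_mapping_eqI, simp add: lookup_annih lookup_add algebra_simps)

lemmas emb_emult_linear [simp] =
  additive.add[OF additive_emb_emult] additive.zero[OF additive_emb_emult]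
  additive.minus[OF additive_emb_emult] additive.diff[OF additive_emb_emult]

lemmas eW_emult_linear [simp] =
  additive.add[OF additive_eW_emult] additive.zero[OF additive_eW_emult]
  additive.minus[OF additive_eW_emult] additive.diff[OF additive_eW_emult]

lemmas annih_linear [simp] =
  additive.add[OF additive_annih] additive.zero[OF additive_annih]
  additive.minus[OF additive_annih] additive.diff[OF additive_annih]

lemma emb_emult_emb_emult [simp]: "emb p \<star> (emb q \<star> f) = emb (p * q) \<star> f"
  by (rule poly_mapping_eqI) (simp add: mult.assoc)

lemma emb_zero_emult [simp]: "emb 0 \<star> f = 0"
  by (rule poly_mapping_eqI) simp

lemma emb_one_emult [simp]: "emb 1 \<star> f = f"
  by (rule poly_mapping_eqI) simp

lemma emb_add_emult: "emb (p + q) \<star> f = emb p \<star> f + emb q \<star> f"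
  by (rule poly_mapping_eqI) (simp add: lookup_add algebra_simps)

lemma emb_uminus_emult [simp]: "emb (- p) \<star> f = - (emb p \<star> f)"
  by (rule poly_mapping_eqI) simp

lemma emb_diff_emult: "emb (p - q) \<star> f = emb p \<star> f - emb q \<star> f"
  by (rule poly_mapping_eqI) (simp add: lookup_minus algebra_simps)

lemma eW_emult_emb_emult [simp]: "eW i \<star> (emb p \<star> f) = emb p \<star> (eW i \<star> f)"
  by (rule poly_mapping_eqI) (simp add: lookup_eW_emult)

lemma annih_emb_emult [simp]: "annih i (emb p \<star> f) = emb p \<star> annih i f"
  by (rule poly_mapping_eqI) (simp add: lookup_annih)

lemma eW_emult_self [simp]: "eW i \<star> (eW i \<star> f) = 0"
  by (rule poly_mapping_eqI) (simp add: lookup_eW_emult)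

lemma eW_emult_anticommute: "eW i \<star> (eW j \<star> f) = - (eW j \<star> (eW i \<star> f))"
proof (cases "i = j")
  case False
  show ?thesis
  proof (rule poly_mapping_eqI)
    fix I
    have "sg i (I - {i}) * sg j (I - {i} - {j}) = (- (sg j (I - {j}) * sg i (I - {j} - {i})) :: 'a pol)"
      if "i \<in> I" "j \<in> I"
    proof -
      \<comment> \<open>Exactly one of i < j and j < i holds, so exactly one of
        \<open>sg i (insert j K)\<close> and \<open>sg j (insert i K)\<close> differs from its value
        on \<open>K\<close>.\<close>
      define K where "K = I - {i} - {j}"
      have "I - {i} = insert j K" "I - {j} = insert i K" "I - {j} - {i} = K" "i \<notin> K" "j \<notin> K"
        using that False by (auto simp: K_def)
      then show ?thesis
        using False by (simp add: sg_insert)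
    qed
    moreover have "I - {i} - {j} = I - {j} - {i}"
      by auto
    ultimately show "Poly_Mapping.lookup (eW i \<star> (eW j \<star> f)) I =
        Poly_Mapping.lookup (- (eW j \<star> (eW i \<star> f))) I"
      using False by (simp add: lookup_eW_emult flip: mult.assoc)
  qed
qed simp

text \<open>This Clifford relation is what makes the sum of the P_i \<omega>_i^- an odd
  derivation.\<close>

lemma annih_eW_emult: "annih i (eW j \<star> f) = (if i = j then f else 0) - eW j \<star> annih i f"
proof (rule poly_mapping_eqI)
  fix I
  show "Poly_Mapping.lookup (annih i (eW j \<star> f)) I =
      Poly_Mapping.lookup ((if i = j then f else 0) - eW j \<star> annih i f) I"
  proof (cases "i = j")
    case True
    then show ?thesis
      by (simp add: lookup_annih lookup_eW_emult lookup_minus insert_absorb)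
  next
    case False
    have "sg i I * sg j (insert i I - {j}) = (- (sg j (I - {j}) * sg i (I - {j})) :: 'a pol)"
      if "i \<notin> I" "j \<in> I"
    proof -
      define K where "K = I - {j}"
      have "I = insert j K" "insert i I - {j} = insert i K" "i \<notin> K" "j \<notin> K"
        using that False by (auto simp: K_def)
      then show ?thesis
        using False by (simp add: sg_insert)
    qed
    moreover have "insert i I - {j} = insert i (I - {j})"
      using False by auto
    ultimately show ?thesis
      using False by (simp add: lookup_annih lookup_eW_emult lookup_minus flip: mult.assoc)
  qed
qed

section \<open>Extended polynomials in $n$ variables\<close>

lemma EPol_iff:
  "f \<in> EPol n \<longleftrightarrow> (\<forall>I. Poly_Mapping.lookup f I \<in> Pol n \<and>
     (Poly_Mapping.lookup f I \<noteq> 0 \<longrightarrow> I \<subseteq> {1..n}))"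
  by (auto simp: EPol_def in_keys_iff)

lemma EPol_zero [simp]: "0 \<in> EPol n"
  by (simp add: EPol_iff)

lemma EPol_add [simp]: "f \<in> EPol n \<Longrightarrow> g \<in> EPol n \<Longrightarrow> f + g \<in> EPol n"
  unfolding EPol_iff by (auto simp: lookup_add) (metis add_0 atLeastAtMost_iff subsetD)+

lemma EPol_uminus [simp]: "f \<in> EPol n \<Longrightarrow> - f \<in> EPol n"
  by (simp add: EPol_iff)

lemma EPol_diff [simp]: "f \<in> EPol n \<Longrightarrow> g \<in> EPol n \<Longrightarrow> f - g \<in> EPol n"
  using EPol_add[OF _ EPol_uminus, of f n g] by simp

lemma EPol_sum: "(\<And>x. x \<in> S \<Longrightarrow> F x \<in> EPol n) \<Longrightarrow> (\<Sum>x\<in>S. F x) \<in> EPol n"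
  by (induction S rule: infinite_finite_induct) simp_all

lemma EPol_emb [simp]: "p \<in> Pol n \<Longrightarrow> emb p \<in> EPol n"
  by (simp add: EPol_iff emb_def lookup_single when_def)

lemma EPol_emb_emult [simp]: "p \<in> Pol n \<Longrightarrow> f \<in> EPol n \<Longrightarrow> emb p \<star> f \<in> EPol n"
  by (simp add: EPol_iff)

lemma EPol_eW_emult [simp]: "i \<in> {1..n} \<Longrightarrow> f \<in> EPol n \<Longrightarrow> eW i \<star> f \<in> EPol n"
proof -
  assume "i \<in> {1..n}" "f \<in> EPol n"
  moreover from this have "I \<subseteq> {1..n}" if "I - {i} \<subseteq> {1..n}" for I
    using that by auto
  ultimately show ?thesis
    by (auto simp: EPol_iff lookup_eW_emult simp del: atLeastAtMost_iff)
qed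

lemma EPol_annih [simp]: "f \<in> EPol n \<Longrightarrow> annih i f \<in> EPol n"
  unfolding EPol_iff lookup_annih by auto

lemma single_insert_eq_eW_emult:
  "i \<notin> J \<Longrightarrow> Poly_Mapping.single (insert i J) p = emb (sg i J) \<star> (eW i \<star> Poly_Mapping.single J p)"
  by (simp add: eW_def emb_def emult_single wsign_singleton)

text \<open>\<open>EPol n\<close> arises from 1 by sums and by left multiplication with polynomials
  and the \<omega>_i, so an identity between additive operators is checked through their commutation
  rules with these multiplications.\<close>

lemma EPol_induct [consumes 1, case_names one scale add eW]:
  fixes f :: "'k::field_char_0 epol"
  assumes f: "f \<in> EPol n"
    and one: "P (emb 1)"
    and scale: "\<And>p f. p \<in> Pol n \<Longrightarrow> f \<in> EPol n \<Longrightarrow> P f \<Longrightarrow> P (emb p \<star> f)"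
    and add: "\<And>f g. f \<in> EPol n \<Longrightarrow> g \<in> EPol n \<Longrightarrow> P f \<Longrightarrow> P g \<Longrightarrow> P (f + g)"
    and eW: "\<And>i f. i \<in> {1..n} \<Longrightarrow> f \<in> EPol n \<Longrightarrow> P f \<Longrightarrow> P (eW i \<star> f)"
  shows "P f"
proof -
  define Q where "Q f \<longleftrightarrow> f \<in> EPol n \<and> P f" for f
  have Qscale: "p \<in> Pol n \<Longrightarrow> Q f \<Longrightarrow> Q (emb p \<star> f)" for p f
    by (simp add: Q_def scale)
  have QeW: "i \<in> {1..n} \<Longrightarrow> Q f \<Longrightarrow> Q (eW i \<star> f)" for i f
    by (simp add: Q_def eW)
  have Q1: "Q (emb 1)"
    by (simp add: Q_def one)
  have Q0: "Q 0"
    using Qscale[OF Pol_zero Q1] by simp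
  have Qbase: "finite I \<Longrightarrow> I \<subseteq> {1..n} \<Longrightarrow> Q (Poly_Mapping.single I 1)" for I
    by (induction I rule: finite_induct)
       (use Q1[unfolded emb_def] in \<open>auto simp: single_insert_eq_eW_emult intro!: Qscale QeW\<close>)
  have Qsum: "finite M \<Longrightarrow> (\<And>I. I \<in> M \<Longrightarrow> Q (F I)) \<Longrightarrow> Q (\<Sum>I\<in>M. F I)"
    for M :: "nat set set" and F
    by (induction M rule: finite_induct) (use Q0 in \<open>auto simp: Q_def add\<close>)
  have "Q (\<Sum>I\<in>Poly_Mapping.keys f. Poly_Mapping.single I (Poly_Mapping.lookup f I))"
  proof (rule Qsum)
    fix I
    assume "I \<in> Poly_Mapping.keys f"
    with f have I: "I \<subseteq> {1..n}" and l: "Poly_Mapping.lookup f I \<in> Pol n"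
      by (auto simp: EPol_def)
    have "Q (emb (Poly_Mapping.lookup f I) \<star> Poly_Mapping.single I 1)"
      using I l finite_subset[OF I] by (intro Qscale Qbase) auto
    then show "Q (Poly_Mapping.single I (Poly_Mapping.lookup f I))"
      by (simp add: emb_def emult_single)
  qed simp
  then show ?thesis
    by (simp add: sum_single_lookup Q_def)
qed

section \<open>The symmetric group action\<close>

lemma emult_add_left: "(f + g) \<star> h = f \<star> h + g \<star> h"
  unfolding emult_def
  by (rule setsum_keys_plus_distrib) (simp_all add: distrib_left distrib_right single_add sum.distrib)

lemma eX_diff: "eX r - eX (Suc r) = emb (xdiff r)"
  by (simp add: eX_def emb_def xdiff_def single_diff)

lemma swap_eW_emult:
  "swap_eW r i \<star> f = eW i \<star> f + (if i = r then emb (xdiff r) \<star> (eW (Suc r) \<star> f) else 0)"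
proof -
  \<comment> \<open>This instance of associativity turns the correction term of
    \<open>swap_eW\<close> into two successive left multiplications.\<close>
  have "emb p \<star> eW j \<star> f = emb p \<star> (eW j \<star> f)" for p j
    by (rule poly_mapping_eqI)
       (simp add: emb_def eW_def emult_single lookup_single_emult lookup_emb_emult[unfolded emb_def] mult_ac)
  then show ?thesis
    by (simp add: swap_eW_def emult_add_left eX_diff)
qed

lemma additive_swap_eW_emult: "additive (\<lambda>f. swap_eW r i \<star> f)"
  by unfold_locales (simp add: swap_eW_emult)

lemmas swap_eW_emult_linear [simp] =
  additive.add[OF additive_swap_eW_emult] additive.zero[OF additive_swap_eW_emult]
  additive.minus[OF additive_swap_eW_emult] additive.diff[OF additive_swap_eW_emult]

lemma swap_eW_emult_emb_emult [simp]: "swap_eW r i \<star> (emb p \<star> f) = emb p \<star> (swap_eW r i \<star> f)"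
  by (simp add: swap_eW_emult mult.commute)

lemma swap_eW_emult_self [simp]: "swap_eW r i \<star> (swap_eW r i \<star> f) = 0"
  by (simp add: swap_eW_emult eW_emult_anticommute[of r "Suc r"])

lemma swap_eW_emult_anticommute:
  "swap_eW r i \<star> (swap_eW r j \<star> f) = - (swap_eW r j \<star> (swap_eW r i \<star> f))"
  using eW_emult_anticommute[of i j f] eW_emult_anticommute[of i "Suc r" f]
    eW_emult_anticommute[of "Suc r" j f]
  by (auto simp: swap_eW_emult)

definition swap_basis :: "nat \<Rightarrow> nat set \<Rightarrow> 'k::field_char_0 epol" where
  "swap_basis r I = foldr (\<star>) (map (swap_eW r) (sorted_list_of_set I)) (emb 1)"

text \<open>The images of the \<omega>_i anticommute, so moving a factor into its sorted place costs
  one sign for each smaller index, just as for the \<omega>_i themselves. This is how s_r becomes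
  multiplicative although it is defined on sorted products.\<close>

lemma foldr_swap_eW_insort:
  assumes "sorted xs" and "distinct xs" and "i \<notin> set xs"
  shows "foldr (\<star>) (map (swap_eW r) (insort i xs)) (emb 1) =
    emb (sg i (set xs)) \<star> (swap_eW r i \<star> foldr (\<star>) (map (swap_eW r) xs) (emb 1))"
  using assms
proof (induction xs)
  case Nil
  then show ?case by (simp add: sg_def)
next
  case (Cons y ys)
  show ?case
  proof (cases "i \<le> y")
    case True
    with Cons.prems have "{j \<in> set (y # ys). j < i} = {}"
      by auto
    with True show ?thesis
      by (simp add: sg_def del: Collect_empty_eq)
  next
    case False
    with Cons show ?thesis
      by (simp add: sg_insert swap_eW_emult_anticommute[of r y i])
  qed
qed

lemma swap_basis_insert:
  assumes "finite J" and "i \<notin> J"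
  shows "swap_basis r (insert i J) = emb (sg i J) \<star> (swap_eW r i \<star> swap_basis r J)"
  using assms foldr_swap_eW_insort[of "sorted_list_of_set J" i r]
  by (simp add: swap_basis_def)

lemma additive_swap_epol: "additive (swap_epol r)"
  unfolding swap_epol_def swap_basis_def[symmetric]
  by unfold_locales
    (rule setsum_keys_plus_distrib, simp_all add: swap_pol_zero swap_pol_add emb_add_emult)

lemmas swap_epol_linear [simp] =
  additive.add[OF additive_swap_epol] additive.zero[OF additive_swap_epol]
  additive.minus[OF additive_swap_epol] additive.diff[OF additive_swap_epol]

lemma swap_epol_single: "swap_epol r (Poly_Mapping.single I p) = emb (swap_pol r p) \<star> swap_basis r I"
  by (cases "p = 0") (simp_all add: swap_epol_def swap_basis_def swap_pol_zero)

lemma swap_epol_one [simp]: "swap_epol r (emb 1) = emb 1"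
  by (simp add: swap_epol_emb swap_pol_one)

text \<open>The induction runs over the summands of a fixed \<open>f\<close>, so that the first case
  knows I to be one of its keys.\<close>

lemma sum_single_induct:
  fixes f :: "'a \<Rightarrow>\<^sub>0 'b::comm_monoid_add"
  assumes "\<And>I p. I \<in> Poly_Mapping.keys f \<Longrightarrow> P (Poly_Mapping.single I p)"
    and "P 0" and "\<And>f g. P f \<Longrightarrow> P g \<Longrightarrow> P (f + g)"
  shows "P f"
proof -
  have "finite M \<Longrightarrow> M \<subseteq> Poly_Mapping.keys f \<Longrightarrow> P (\<Sum>I\<in>M. Poly_Mapping.single I (F I))" for M F
    by (induction M rule: finite_induct) (auto simp: assms)
  from this[of "Poly_Mapping.keys f" "Poly_Mapping.lookup f"] show ?thesis
    by (simp add: sum_single_lookup)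
qed

lemma swap_epol_emb_emult [simp]: "swap_epol r (emb p \<star> f) = emb (swap_pol r p) \<star> swap_epol r f"
proof (induction f rule: sum_single_induct)
  case (1 I q)
  have "emb p \<star> Poly_Mapping.single I q = Poly_Mapping.single I (p * q)"
    by (simp add: emb_def emult_single)
  then show ?case
    by (simp add: swap_epol_single swap_pol_mult)
qed simp_all

text \<open>Membership in \<open>EPol n\<close> makes every key finite;
  \<open>sorted_list_of_set\<close> is the empty list on infinite sets.\<close>

lemma swap_epol_eW_emult:
  assumes "f \<in> EPol n"
  shows "swap_epol r (eW i \<star> f) = swap_eW r i \<star> swap_epol r f"
proof (induction f rule: sum_single_induct)
  case (1 I p)
  with assms have "finite I"
    by (auto simp: EPol_def intro: finite_subset)
  show ?case
  proof (cases "i \<in> I")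
    \<comment> \<open>Both sides vanish: \<omega>_i is already a factor, and s_r(\<omega>_i) squares
      to zero.\<close>
    case True
    define J where "J = I - {i}"
    have "I = insert i J" "i \<notin> J" "finite J"
      using True \<open>finite I\<close> by (auto simp: J_def)
    then show ?thesis
      by (simp add: swap_epol_single swap_basis_insert) (simp add: eW_def emult_single wsign_singleton)
  next
    case False
    have "eW i \<star> Poly_Mapping.single I p = Poly_Mapping.single (insert i I) (sg i I * p)"
      using False by (simp add: eW_def emult_single wsign_singleton)
    then show ?thesis
      using False \<open>finite I\<close>
      by (simp add: swap_epol_single swap_basis_insert swap_pol_mult mult_ac)
  qed
qed simp_all

lemma EPol_swap_eW_emult:
  "r \<in> {1..<n} \<Longrightarrow> i \<in> {1..n} \<Longrightarrow> f \<in> EPol n \<Longrightarrow> swap_eW r i \<star> f \<in> EPol n"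
  by (simp add: swap_eW_emult)

lemma EPol_swap_epol [simp]:
  assumes r: "r \<in> {1..<n}" and "f \<in> EPol n"
  shows "swap_epol r f \<in> EPol n"
  using assms(2)
  by (induction rule: EPol_induct) (use r in \<open>simp_all add: swap_epol_eW_emult EPol_swap_eW_emult\<close>)

text \<open>On \<omega>_r the two correction terms cancel because s_r negates X_r - X_(r+1).\<close>

lemma swap_epol_swap_epol:
  assumes r: "r \<in> {1..<n}" and "f \<in> EPol n"
  shows "swap_epol r (swap_epol r f) = f"
  using assms(2)
proof (induction rule: EPol_induct)
  case (eW i f)
  then show ?case
    using r by (simp add: swap_epol_eW_emult[of _ n] swap_eW_emult swap_pol_xdiff)
qed (simp_all add: swap_pol_swap_pol)

section \<open>Demazure operators\<close>

text \<open>The coefficients lie in a domain. Identities for \<open>demazure\<close> are multiplied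
  by X_r - X_(r+1) and become identities for s_r.\<close>

lemma emb_xdiff_cancel: "emb (xdiff r) \<star> f = emb (xdiff r) \<star> g \<Longrightarrow> f = g"
  by (intro poly_mapping_eqI xdiff_cancel[of r]) (simp flip: lookup_emb_emult)

lemma swap_epol_quotient:
  assumes r: "r \<in> {1..<n}" and "f \<in> EPol n"
  shows "\<exists>g\<in>EPol n. emb (xdiff r) \<star> g = f - swap_epol r f"
  using assms(2)
proof (induction rule: EPol_induct)
  case one
  then show ?case by (intro bexI[of _ 0]) simp_all
next
  case (scale p f)
  then obtain g where g: "g \<in> EPol n" "emb (xdiff r) \<star> g = f - swap_epol r f"
    by blast
  obtain q where q: "q \<in> Pol n" "xdiff r * q = p - swap_pol r p"
    using swap_pol_quotient[OF r scale(1)] by blast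
  \<comment> \<open>The witness is the twisted Leibniz rule T_r(p f) = T_r(p) f + s_r(p)
    T_r(f).\<close>
  have "emb (xdiff r) \<star> (emb q \<star> f + emb (swap_pol r p) \<star> g) =
      emb (p - swap_pol r p) \<star> f + emb (swap_pol r p) \<star> (emb (xdiff r) \<star> g)"
    by (simp add: mult.commute flip: q(2))
  also have "\<dots> = emb p \<star> f - swap_epol r (emb p \<star> f)"
    by (simp add: g emb_diff_emult)
  finally show ?case
    by (rule bexI) (use q g scale r in simp)
next
  case (add f f')
  then obtain g g' where "g \<in> EPol n" "g' \<in> EPol n" "emb (xdiff r) \<star> g = f - swap_epol r f"
      "emb (xdiff r) \<star> g' = f' - swap_epol r f'"
    by blast
  then show ?case
    by (intro bexI[of _ "g + g'"]) simp_all
next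
  case (eW i f)
  then obtain g where g: "g \<in> EPol n" "emb (xdiff r) \<star> g = f - swap_epol r f"
    by blast
  \<comment> \<open>T_r(\<omega>_i f) is \<omega>_i T_r(f), corrected for i = r by - \<omega>_(r+1)
    s_r(f).\<close>
  have "emb (xdiff r) \<star> (eW i \<star> g - (if i = r then eW (Suc r) \<star> swap_epol r f else 0)) =
      eW i \<star> (emb (xdiff r) \<star> g) - (if i = r then emb (xdiff r) \<star> (eW (Suc r) \<star> swap_epol r f) else 0)"
    by simp
  also have "\<dots> = eW i \<star> f - swap_epol r (eW i \<star> f)"
    by (simp only: g swap_epol_eW_emult[OF eW(2)]) (simp add: swap_eW_emult)
  finally show ?case
    by (rule bexI) (use r eW g in simp)
qed

lemma demazure_eqI:
  assumes "g \<in> EPol n" and "emb (xdiff r) \<star> g = f - swap_epol r f"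
  shows "demazure n r f = g"
  unfolding demazure_def eX_diff
  by (rule the_equality) (use assms in \<open>auto intro: emb_xdiff_cancel[of r]\<close>)

lemma
  assumes "r \<in> {1..<n}" and "f \<in> EPol n"
  shows EPol_demazure [simp]: "demazure n r f \<in> EPol n"
    and xdiff_demazure: "emb (xdiff r) \<star> demazure n r f = f - swap_epol r f"
  using swap_epol_quotient[OF assms] demazure_eqI by metis+

section \<open>The parity involution\<close>

definition parity_inv :: "'k::field_char_0 epol \<Rightarrow> 'k epol" where
  "parity_inv = Poly_Mapping.mapp (\<lambda>I p. (- 1) ^ card I * p)"

lemma lookup_parity_inv:
  "Poly_Mapping.lookup (parity_inv f) I = (- 1) ^ card I * Poly_Mapping.lookup f I"
  by (simp add: parity_inv_def lookup_mapp when_def in_keys_iff)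

lemma additive_parity_inv: "additive parity_inv"
  by unfold_locales (rule poly_mapping_eqI, simp add: lookup_parity_inv lookup_add algebra_simps)

lemmas parity_inv_linear [simp] =
  additive.add[OF additive_parity_inv] additive.zero[OF additive_parity_inv]
  additive.minus[OF additive_parity_inv] additive.diff[OF additive_parity_inv]

lemma parity_inv_emb_emult [simp]: "parity_inv (emb p \<star> f) = emb p \<star> parity_inv f"
  by (rule poly_mapping_eqI) (simp add: lookup_parity_inv)

lemma parity_inv_one [simp]: "parity_inv (emb 1) = emb 1"
  by (rule poly_mapping_eqI) (simp add: lookup_parity_inv emb_def lookup_single when_def)

lemma parity_inv_parity_inv [simp]: "parity_inv (parity_inv f) = f"
proof (rule poly_mapping_eqI)
  fix I :: "nat set"
  have "(- 1) ^ card I * ((- 1) ^ card I * p) = p" for p :: "'a pol"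
    by (simp flip: mult.assoc power_mult_distrib)
  then show "Poly_Mapping.lookup (parity_inv (parity_inv f)) I = Poly_Mapping.lookup f I"
    by (simp add: lookup_parity_inv)
qed

lemma EPol_parity_inv [simp]: "f \<in> EPol n \<Longrightarrow> parity_inv f \<in> EPol n"
  by (simp add: EPol_iff lookup_parity_inv)

lemma EPol_finite: "f \<in> EPol n \<Longrightarrow> Poly_Mapping.lookup f I \<noteq> 0 \<Longrightarrow> finite I"
  by (auto simp: EPol_iff intro: finite_subset)

text \<open>Each nonzero term gains one exterior factor. Its key has to be finite, since
  \<open>card\<close> is 0 on infinite sets.\<close>

lemma parity_inv_eW_emult:
  assumes "f \<in> EPol n"
  shows "parity_inv (eW i \<star> f) = - (eW i \<star> parity_inv f)"
proof (rule poly_mapping_eqI)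
  fix I
  show "Poly_Mapping.lookup (parity_inv (eW i \<star> f)) I =
      Poly_Mapping.lookup (- (eW i \<star> parity_inv f)) I"
  proof (cases "i \<in> I \<and> Poly_Mapping.lookup f (I - {i}) \<noteq> 0")
    case True
    with EPol_finite[OF assms, of "I - {i}"] have "finite I"
      by simp
    with True obtain m where "card I = Suc m"
      using card.remove[of I i] by fast
    then show ?thesis
      using True by (simp add: lookup_parity_inv lookup_eW_emult mult_ac)
  qed (auto simp: lookup_parity_inv lookup_eW_emult)
qed

lemma parity_inv_annih:
  assumes "f \<in> EPol n"
  shows "parity_inv (annih i f) = - annih i (parity_inv f)"
proof (rule poly_mapping_eqI)
  fix I
  show "Poly_Mapping.lookup (parity_inv (annih i f)) I =
      Poly_Mapping.lookup (- annih i (parity_inv f)) I"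
  proof (cases "i \<notin> I \<and> Poly_Mapping.lookup f (insert i I) \<noteq> 0")
    case True
    with EPol_finite[OF assms, of "insert i I"] have "finite I"
      by simp
    with True show ?thesis
      by (simp add: lookup_parity_inv lookup_annih mult_ac)
  qed (auto simp: lookup_parity_inv lookup_annih)
qed

text \<open>s_r preserves the exterior degree, as s_r(\<omega>_r) is again linear in the
  \<omega>_i.\<close>

lemma parity_inv_swap_epol:
  assumes r: "r \<in> {1..<n}" and "f \<in> EPol n"
  shows "parity_inv (swap_epol r f) = swap_epol r (parity_inv f)"
  using assms(2)
proof (induction rule: EPol_induct)
  case (eW i f)
  then show ?case
    using r by (simp add: swap_epol_eW_emult[of _ n] parity_inv_eW_emult[of _ n] swap_eW_emult)
qed simp_all

lemma parity_inv_demazure: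
  assumes "r \<in> {1..<n}" and "f \<in> EPol n"
  shows "parity_inv (demazure n r f) = demazure n r (parity_inv f)"
proof (rule emb_xdiff_cancel)
  show "emb (xdiff r) \<star> parity_inv (demazure n r f) = emb (xdiff r) \<star> demazure n r (parity_inv f)"
    using assms by (simp add: xdiff_demazure parity_inv_swap_epol[of r n] flip: parity_inv_emb_emult)
qed

section \<open>Identities for the Demazure operators\<close>

lemma demazure_add:
  assumes "r \<in> {1..<n}" and "f \<in> EPol n" and "g \<in> EPol n"
  shows "demazure n r (f + g) = demazure n r f + demazure n r g"
  using assms by (intro demazure_eqI) (simp_all add: xdiff_demazure)

lemma demazure_eW_emult:
  assumes "r \<in> {1..<n}" and "f \<in> EPol n"
  shows "demazure n r (eW r \<star> f) = eW r \<star> demazure n r f - eW (Suc r) \<star> swap_epol r f"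
  using assms
  by (intro demazure_eqI)
     (simp_all add: xdiff_demazure swap_epol_eW_emult[of _ n] swap_eW_emult flip: eW_emult_emb_emult)

text \<open>f - s_r f and X_r - X_(r+1) are both negated by s_r, so the quotient is
  invariant.\<close>

lemma swap_epol_demazure:
  assumes "r \<in> {1..<n}" and "f \<in> EPol n"
  shows "swap_epol r (demazure n r f) = demazure n r f"
proof (rule emb_xdiff_cancel)
  have "swap_epol r (emb (xdiff r) \<star> demazure n r f) = - (emb (xdiff r) \<star> demazure n r f)"
    using assms by (simp add: xdiff_demazure swap_epol_swap_epol[of r n] del: swap_epol_emb_emult)
  then show "emb (xdiff r) \<star> swap_epol r (demazure n r f) = emb (xdiff r) \<star> demazure n r f"
    by (simp add: swap_pol_xdiff)
qed

lemma demazure_demazure: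
  assumes "r \<in> {1..<n}" and "f \<in> EPol n"
  shows "demazure n r (demazure n r f) = 0"
  using assms by (intro demazure_eqI) (simp_all add: swap_epol_demazure)

section \<open>The polynomials $P_i$\<close>

text \<open>For i in {1..n} the extended polynomial P_i involves no \<omega>. Its coefficient at the
  empty set lives in a domain, where X_r - X_(r+1) can be cancelled.\<close>

definition dpol :: "nat \<Rightarrow> nat \<Rightarrow> nat \<Rightarrow> 'k::field_char_0 pol" where
  "dpol n N i = Poly_Mapping.lookup (Pseq n N i) {}"

lemma emb_emult_emb: "emb p \<star> emb q = emb (p * q)"
  by (simp add: emb_def emult_single)

lemma emb_uminus: "- emb p = emb (- p)"
  by (simp add: emb_def single_uminus)

lemma emb_diff: "emb p - emb q = emb (p - q)"
  by (simp add: emb_def single_diff)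

lemma lookup_emb_empty [simp]: "Poly_Mapping.lookup (emb p) {} = p"
  by (simp add: emb_def)

lemma demazure_emb:
  assumes "q \<in> Pol n" and "xdiff r * q = p - swap_pol r p"
  shows "demazure n r (emb p) = emb q"
  using assms by (intro demazure_eqI) (simp_all add: emb_emult_emb swap_epol_emb emb_diff)

text \<open>The claims go together, since the quotient defining P_(i+1) is formed from P_i as an
  element of \<open>Pol n\<close>. The last one is the recursion cleared of its denominator;
  \<open>1 \<le> j\<close> keeps away from the dummy value at index 0.\<close>

lemma Pseq_eq_emb_aux:
  "i \<in> {1..n} \<Longrightarrow>
     Pseq n N i = emb (dpol n N i :: 'k::field_char_0 pol) \<and> (dpol n N i :: 'k pol) \<in> Pol n \<and>
     (\<forall>j. i = Suc j \<longrightarrow> 1 \<le> j \<longrightarrow>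
        xdiff j * dpol n N i = swap_pol j (dpol n N j :: 'k pol) - dpol n N j)"
proof (induction i)
  case (Suc i)
  show ?case
  proof (cases "i = 0")
    case True
    then show ?thesis using Suc.prems by (simp add: dpol_def)
  next
    case False
    with Suc have IH: "Pseq n N i = emb (dpol n N i :: 'k pol)" "(dpol n N i :: 'k pol) \<in> Pol n"
      and i: "i \<in> {1..<n}"
      by auto
    obtain q where q: "q \<in> Pol n" "xdiff i * q = dpol n N i - swap_pol i (dpol n N i :: 'k pol)"
      using swap_pol_quotient[OF i IH(2)] by blast
    have "Pseq n N (Suc i) = - demazure n i (Pseq n N i :: 'k epol)"
      using False by (cases i) auto
    also have "\<dots> = emb (- q)"
      by (simp add: IH(1) demazure_emb[OF q] emb_uminus)
    finally show ?thesis
      using q by (simp add: dpol_def)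
  qed
qed simp

lemma
  assumes "i \<in> {1..n}"
  shows Pseq_eq_emb: "Pseq n N i = emb (dpol n N i)"
    and Pol_dpol [simp]: "dpol n N i \<in> Pol n"
  using Pseq_eq_emb_aux[OF assms] by blast+

lemma dpol_1: "dpol n N (Suc 0) = pX 1 ^ N"
  by (simp add: dpol_def)

lemma xdiff_dpol:
  assumes "j \<in> {1..<n}"
  shows "xdiff j * dpol n N (Suc j) = swap_pol j (dpol n N j) - dpol n N j"
  using Pseq_eq_emb_aux[of "Suc j" n N] assms by auto

text \<open>Strong induction, because the case r = i - 2 goes back two steps to P_r. Otherwise P_1
  involves X_1 only, P_(r+1) is a quotient by X_r - X_(r+1), or the transpositions are distant and
  commute.\<close>

lemma swap_pol_dpol:
  assumes "i \<in> {1..n}" and "r \<in> {1..<n}" and "r \<noteq> i"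
  shows "swap_pol r (dpol n N i) = (dpol n N i :: 'k::field_char_0 pol)"
  using assms
proof (induction i arbitrary: r rule: less_induct)
  case (less i)
  let ?P = "\<lambda>i. dpol n N i :: 'k pol"
  consider "i = 1" | "i = Suc r" | j where "i = Suc j" "j \<in> {1..<n}" "Suc r = j"
    | j where "i = Suc j" "j \<in> {1..<n}" "Suc r < j \<or> Suc j < r"
    using less.prems by (cases i) force+
  then show ?case
  proof cases
    case 1
    then show ?thesis
      using less.prems by (simp add: dpol_1 swap_pol_power swap_pol_pX transpose_def)
  next
    case 2
    \<comment> \<open>s_r negates X_r - X_(r+1) and also its product with P_(r+1), which is s_r(P_r)
      - P_r.\<close>
    have "xdiff r * swap_pol r (?P i) = - swap_pol r (xdiff r * ?P i)"
      by (simp add: swap_pol_mult swap_pol_xdiff)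
    also have "\<dots> = xdiff r * ?P i"
      using less.prems by (simp add: 2 xdiff_dpol swap_pol_diff swap_pol_swap_pol)
    finally show ?thesis by (rule xdiff_cancel)
  next
    case (4 j)
    have x: "swap_pol r (xdiff j) = (xdiff j :: 'k pol)"
      using 4 by (auto simp: xdiff_def swap_pol_diff swap_pol_pX transpose_def)
    have IH: "swap_pol r (?P j) = ?P j"
      using 4 less.prems by (intro less.IH) auto
    have "xdiff j * swap_pol r (?P i) = swap_pol r (xdiff j * ?P i)"
      by (simp add: swap_pol_mult x)
    also have "\<dots> = xdiff j * ?P i"
      using 4 swap_pol_comm[of j r "?P j"] by (auto simp: xdiff_dpol swap_pol_diff IH)
    finally show ?thesis by (rule xdiff_cancel)
  next
    case (3 j)
    define a b c :: "'k pol" where "a = pX r" and "b = pX (Suc r)" and "c = pX (Suc (Suc r))"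
    define f g h where "f = ?P r" and "g = swap_pol r f" and "h = swap_pol j g"
    note 3 = 3(1,2) 3(3)[symmetric]
    have s: "swap_pol r a = b" "swap_pol r b = a" "swap_pol r c = c" "swap_pol r f = g" "swap_pol r g = f"
      "swap_pol j a = a" "swap_pol j b = c" "swap_pol j c = b"
      by (auto simp: a_def b_def c_def g_def 3 swap_pol_pX transpose_def swap_pol_swap_pol)
    have fj: "swap_pol j f = f"
      using 3 less.prems unfolding f_def by (intro less.IH) auto
    \<comment> \<open>The braid relation gives s_r s_j s_r f = s_j s_r s_j f, and s_j fixes
      \<open>f\<close>.\<close>
    have h: "swap_pol r h = h"
      unfolding h_def g_def using fj swap_pol_braid[of r f] by (simp add: 3)
    have P1: "(a - b) * ?P j = g - f"
      using xdiff_dpol[of r n N] 3 less.prems by (simp add: a_def b_def f_def g_def xdiff_def)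
    have P2: "(b - c) * ?P i = swap_pol j (?P j) - ?P j"
      using xdiff_dpol[of j n N] 3 by (simp add: b_def c_def xdiff_def)
    have P3: "(a - c) * swap_pol j (?P j) = h - f"
      using arg_cong[OF P1, of "swap_pol j"] by (simp add: swap_pol_mult swap_pol_diff s fj h_def)
    \<comment> \<open>\<open>?P i\<close> is the divided difference of \<open>f\<close>, \<open>g\<close>, \<open>h\<close> at \<open>a\<close>, \<open>b\<close>, \<open>c\<close>: the quotient of an
      alternating polynomial by the Vandermonde product \<open>V\<close>.\<close>
    define V where "V = (a - b) * (a - c) * (b - c)"
    have "V * ?P i = (a - b) * (a - c) * ((b - c) * ?P i)"
      by (simp add: V_def)
    also have "\<dots> = (a - b) * ((a - c) * swap_pol j (?P j)) - (a - c) * ((a - b) * ?P j)"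
      unfolding P2 by (simp add: algebra_simps)
    also have "\<dots> = (a - b) * (h - f) - (a - c) * (g - f)"
      by (simp only: P1 P3)
    finally have V: "V * ?P i = (a - b) * (h - f) - (a - c) * (g - f)" .
    \<comment> \<open>s_r exchanges \<open>a\<close> with \<open>b\<close> and \<open>f\<close> with
      \<open>g\<close>, so it negates \<open>V\<close> and the numerator alike.\<close>
    have "V * swap_pol r (?P i) = - swap_pol r (V * ?P i)"
      by (simp add: V_def swap_pol_mult swap_pol_diff s) (simp add: algebra_simps)
    also have "\<dots> = V * ?P i"
      unfolding V by (simp add: swap_pol_mult swap_pol_diff s h) (simp add: algebra_simps)
    finally have "V * swap_pol r (?P i) = V * ?P i" .
    moreover have "V \<noteq> 0"
      by (simp add: V_def a_def b_def c_def pX_inject)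
    ultimately show ?thesis by simp
  qed
qed

section \<open>The derivation $\sum_i P_i\,\omega_i^-$ of $\mathrm{EPol}_n$\<close>

definition dder :: "nat \<Rightarrow> nat \<Rightarrow> 'k::field_char_0 epol \<Rightarrow> 'k epol" where
  "dder n N f = (\<Sum>i\<in>{1..n}. emb (dpol n N i) \<star> annih i f)"

lemma additive_dder: "additive (dder n N)"
  by unfold_locales (simp add: dder_def sum.distrib)

lemmas dder_linear [simp] =
  additive.add[OF additive_dder] additive.zero[OF additive_dder]
  additive.minus[OF additive_dder] additive.diff[OF additive_dder]

lemma dder_emb_emult [simp]: "dder n N (emb p \<star> f) = emb p \<star> dder n N f"
  by (simp add: dder_def additive.sum[OF additive_emb_emult] mult.commute)

lemma dder_eW_emult:
  assumes "i \<in> {1..n}"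
  shows "dder n N (eW i \<star> f) = emb (dpol n N i) \<star> f - eW i \<star> dder n N f"
proof -
  have "dder n N (eW i \<star> f) =
      (\<Sum>j\<in>{1..n}. (if j = i then emb (dpol n N i) \<star> f else 0) - eW i \<star> (emb (dpol n N j) \<star> annih j f))"
    unfolding dder_def by (rule sum.cong) (auto simp: annih_eW_emult)
  also have "\<dots> = emb (dpol n N i) \<star> f - eW i \<star> dder n N f"
    using assms by (simp only: sum_subtractf sum.delta finite_atLeastAtMost if_True dder_def
        additive.sum[OF additive_eW_emult])
  finally show ?thesis .
qed

lemma annih_one [simp]: "annih i (emb 1) = 0"
  by (simp add: emb_def annih_zero)

lemma dder_one [simp]: "dder n N (emb 1) = 0"
  by (simp add: dder_def)

lemma EPol_dder [simp]: "f \<in> EPol n \<Longrightarrow> dder n N f \<in> EPol n"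
  unfolding dder_def by (intro EPol_sum EPol_emb_emult Pol_dpol EPol_annih)

lemma dder_swap_epol:
  assumes r: "r \<in> {1..<n}" and "f \<in> EPol n"
  shows "dder n N (swap_epol r f) = swap_epol r (dder n N f)"
  using assms(2)
proof (induction rule: EPol_induct)
  case (eW i f)
  show ?case
  proof (cases "i = r")
    case False
    then show ?thesis
      using eW r by (simp add: swap_epol_eW_emult[of _ n] swap_eW_emult dder_eW_emult swap_pol_dpol)
  next
    case True
    \<comment> \<open>Rewritten as P_r + (X_r - X_(r+1)) P_(r+1) = s_r(P_r), the recursion says that
      the derivation sends s_r(\<omega>_r) to s_r(P_r).\<close>
    have "xdiff r * dpol n N (Suc r) = swap_pol r (dpol n N r) - (dpol n N r :: 'a pol)"
      using r by (rule xdiff_dpol)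
    with True show ?thesis
      using eW r by (simp add: swap_epol_eW_emult[of _ n] swap_eW_emult dder_eW_emult emb_diff_emult)
  qed
qed simp_all

lemma dder_demazure:
  assumes "r \<in> {1..<n}" and "f \<in> EPol n"
  shows "dder n N (demazure n r f) = demazure n r (dder n N f)"
proof (rule emb_xdiff_cancel)
  show "emb (xdiff r) \<star> dder n N (demazure n r f) = emb (xdiff r) \<star> demazure n r (dder n N f)"
    using assms by (simp add: xdiff_demazure dder_swap_epol[of r n] flip: dder_emb_emult)
qed

section \<open>Operators\<close>

text \<open>Extensionality makes operators comparable pointwise, closure lets \<open>compose\<close>
  be evaluated repeatedly, and additivity gives A (B + C) = A B + A C.\<close>

definition endo :: "nat \<Rightarrow> 'k::field_char_0 eop \<Rightarrow> bool" where
  "endo n A \<longleftrightarrow> A \<in> extensional (EPol n) \<and> (\<forall>f\<in>EPol n. A f \<in> EPol n) \<and>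
     (\<forall>f\<in>EPol n. \<forall>g\<in>EPol n. A (f + g) = A f + A g)"

lemma op_extensional [simp]:
  "ozero n \<in> extensional (EPol n)" "oone n \<in> extensional (EPol n)"
  "oadd n A B \<in> extensional (EPol n)" "oscale n c A \<in> extensional (EPol n)"
  "osum n F S \<in> extensional (EPol n)" "lmul n a \<in> extensional (EPol n)"
  "opX n i \<in> extensional (EPol n)" "opWp n i \<in> extensional (EPol n)"
  "opWm n i \<in> extensional (EPol n)" "opT n r \<in> extensional (EPol n)"
  by (simp_all add: ozero_def oone_def oadd_def oscale_def osum_def lmul_def opX_def opWp_def
      opWm_def opT_def)

lemma op_apply [simp]:
  assumes "f \<in> EPol n"
  shows "ozero n f = 0" "oone n f = f" "oadd n A B f = A f + B f"
    "oscale n c A f = emb (Poly_Mapping.single 0 c) \<star> A f"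
    "osum n F S f = (\<Sum>i\<in>S. F i f)" "omult n A B f = A (B f)" "lmul n a f = a \<star> f"
    "opX n i f = emb (pX i) \<star> f" "opWp n i f = eW i \<star> f" "opWm n i f = annih i f"
    "opT n r f = demazure n r f"
  using assms
  by (simp_all add: ozero_def oone_def oadd_def oscale_def osum_def lmul_def opX_def opWp_def
      opWm_def opT_def escale_def compose_eq eX_def)

lemma endo_extensional: "endo n A \<Longrightarrow> A \<in> extensional (EPol n)"
  by (simp add: endo_def)

lemma endo_closed [simp]: "endo n A \<Longrightarrow> f \<in> EPol n \<Longrightarrow> A f \<in> EPol n"
  by (simp add: endo_def)

lemma endo_plus: "endo n A \<Longrightarrow> f \<in> EPol n \<Longrightarrow> g \<in> EPol n \<Longrightarrow> A (f + g) = A f + A g"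
  by (simp add: endo_def)

lemma endo_0: "endo n A \<Longrightarrow> A 0 = 0"
  using endo_plus[of n A 0 0] by simp

lemma endo_minus: "endo n A \<Longrightarrow> f \<in> EPol n \<Longrightarrow> A (- f) = - A f"
  using endo_plus[of n A f "- f"] by (simp add: endo_0 eq_neg_iff_add_eq_0 add.commute)

lemma endo_diff: "endo n A \<Longrightarrow> f \<in> EPol n \<Longrightarrow> g \<in> EPol n \<Longrightarrow> A (f - g) = A f - A g"
  using endo_plus[of n A f "- g"] by (simp add: endo_minus)

lemma endo_ops:
  "endo n (ozero n)" "endo n (oone n)" "endo n A \<Longrightarrow> endo n (oscale n c A)"
  "endo n A \<Longrightarrow> endo n B \<Longrightarrow> endo n (oadd n A B)"
  "endo n A \<Longrightarrow> endo n B \<Longrightarrow> endo n (omult n A B)"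
  by (simp_all add: endo_def)

lemma endo_gens:
  "i \<in> {1..n} \<Longrightarrow> endo n (opX n i)" "i \<in> {1..n} \<Longrightarrow> endo n (opWp n i)"
  "endo n (opWm n i)" "r \<in> {1..<n} \<Longrightarrow> endo n (opT n r)"
  by (simp_all add: endo_def demazure_add)

section \<open>Homogeneous elements of a generated subalgebra\<close>

lemma oscale_0: "oscale n 0 A = ozero n"
  by (rule extensionalityI[of _ "EPol n"]) simp_all

lemma homogeneous_imp_generated:
  "homogeneous n D d A \<Longrightarrow> A \<in> generated_subalgebra n (fst ` D)"
proof (induction rule: homogeneous.induct)
  case (gen A d)
  then show ?case
    by (force intro: generated_subalgebra.gen)
next
  case (zero d)
  have "oscale n 0 (oone n) \<in> generated_subalgebra n (fst ` D)"
    by (intro generated_subalgebra.intros)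
  then show ?case
    by (simp only: oscale_0)
qed (simp_all add: generated_subalgebra.intros)

lemma homogeneous_endo:
  assumes "\<And>A d. (A, d) \<in> D \<Longrightarrow> endo n A" and "homogeneous n D d A"
  shows "endo n A"
  using assms(2) by induction (auto intro: assms(1) endo_ops)

text \<open>Records spanning without directness; for parities, directness is
  \<open>EENH_parts_unique\<close>.\<close>

inductive_set homogeneous_sums ::
  "nat \<Rightarrow> ('k::field_char_0 eop \<times> 'd::comm_monoid_add) set \<Rightarrow> 'k eop set"
  for n :: nat and D :: "('k eop \<times> 'd) set" where
  hom: "homogeneous n D d A \<Longrightarrow> A \<in> homogeneous_sums n D"
| add: "A \<in> homogeneous_sums n D \<Longrightarrow> B \<in> homogeneous_sums n D \<Longrightarrow>
    oadd n A B \<in> homogeneous_sums n D"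

text \<open>Products are expanded by the two distributive laws. The one with the sum on the right
  uses additivity of the left factor, hence the hypothesis on \<open>D\<close>.\<close>

lemma generated_imp_homogeneous_sums:
  fixes D :: "('k::field_char_0 eop \<times> 'd::comm_monoid_add) set"
  assumes D: "\<And>A d. (A, d) \<in> D \<Longrightarrow> endo n A"
    and A: "A \<in> generated_subalgebra n (fst ` D)"
  shows "A \<in> homogeneous_sums n D"
proof -
  let ?H = "homogeneous_sums n D"
  have endo: "endo n A" if "A \<in> ?H" for A
    using that by induction (auto intro: homogeneous_endo[OF D] endo_ops)
  have scale: "oscale n c A \<in> ?H" if "A \<in> ?H" for A c
    using that
  proof induction
    case (hom d A)
    then show ?case by (intro homogeneous_sums.hom homogeneous.scale)
  next
    case (add A B)
    have "oscale n c (oadd n A B) = oadd n (oscale n c A) (oscale n c B)"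
      by (rule extensionalityI[of _ "EPol n"]) simp_all
    with add show ?case by (simp add: homogeneous_sums.add)
  qed
  have mult_hom: "omult n A B \<in> ?H" if A: "homogeneous n D d A" and "B \<in> ?H" for A B d
    using that(2)
  proof induction
    case (hom e B)
    show ?case by (rule homogeneous_sums.hom[OF homogeneous.mult[OF A hom]])
  next
    case (add B C)
    have "omult n A (oadd n B C) = oadd n (omult n A B) (omult n A C)"
      using homogeneous_endo[OF D A] add(1,2)[THEN endo]
      by (intro extensionalityI[of _ "EPol n"]) (simp_all add: endo_plus[of n])
    with add show ?case by (simp add: homogeneous_sums.add)
  qed
  have mult: "omult n A B \<in> ?H" if "A \<in> ?H" and B: "B \<in> ?H" for A B
    using that(1)
  proof induction
    case (hom d A)
    then show ?case using B by (rule mult_hom)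
  next
    case (add A C)
    have "omult n (oadd n A C) B = oadd n (omult n A B) (omult n C B)"
      using B[THEN endo]
      by (intro extensionalityI[of _ "EPol n"]) simp_all
    with add show ?case by (simp add: homogeneous_sums.add)
  qed
  show ?thesis
    using A
  proof induction
    case (gen A)
    then obtain d where "(A, d) \<in> D" by auto
    then show ?case by (intro homogeneous_sums.hom homogeneous.gen)
  next
    case one
    show ?case by (rule homogeneous_sums.hom[OF homogeneous.one])
  qed (simp_all add: scale mult homogeneous_sums.add)
qed

lemma homogeneous_lmul_emb:
  assumes D: "\<And>i. i \<in> {1..n} \<Longrightarrow> (opX n i, 0) \<in> D" and "p \<in> Pol n"
  shows "homogeneous n D 0 (lmul n (emb p))"
  using assms(2)
proof (induction rule: Pol_induct)
  case (const c)
  have "lmul n (emb (Poly_Mapping.single 0 c)) = oscale n c (oone n)"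
    by (rule extensionalityI[of _ "EPol n"]) simp_all
  then show ?case
    by (simp add: homogeneous.scale homogeneous.one)
next
  case (var i)
  then show ?case
    using homogeneous.gen[OF D] by (simp add: opX_def eX_def)
next
  case (add p q)
  have "lmul n (emb (p + q)) = oadd n (lmul n (emb p)) (lmul n (emb q))"
    by (rule extensionalityI[of _ "EPol n"]) (simp_all add: emb_add_emult)
  with add show ?case
    by (simp add: homogeneous.add)
next
  case (mult p q)
  have "lmul n (emb (p * q)) = omult n (lmul n (emb p)) (lmul n (emb q))"
    using mult by (intro extensionalityI[of _ "EPol n"]) simp_all
  with mult homogeneous.mult[of n D 0 _ 0] show ?case
    by simp
qed

lemma homogeneous_osum:
  "(\<And>i. i \<in> S \<Longrightarrow> homogeneous n D d (F i)) \<Longrightarrow> homogeneous n D d (osum n F S)"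
proof (induction S rule: infinite_finite_induct)
  case (insert i S)
  have "osum n F (insert i S) = oadd n (F i) (osum n F S)"
    using insert by (intro extensionalityI[of _ "EPol n"]) simp_all
  with insert show ?case
    by (simp add: homogeneous.add)
next
  case empty
  have "osum n F {} = ozero n"
    by (rule extensionalityI[of _ "EPol n"]) simp_all
  then show ?case by (simp add: homogeneous.zero)
next
  case (infinite S)
  then have "osum n F S = ozero n"
    by (intro extensionalityI[of _ "EPol n"]) simp_all
  then show ?case by (simp add: homogeneous.zero)
qed

section \<open>The superalgebra structure\<close>

text \<open>Acts as 1 on even and as -1 on odd operators, and so replaces the sign (-1)^|A| when A
  is not homogeneous.\<close>

definition parity_conj :: "nat \<Rightarrow> 'k::field_char_0 eop \<Rightarrow> 'k eop" where
  "parity_conj n A = (\<lambda>f\<in>EPol n. parity_inv (A (parity_inv f)))"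

lemma parity_conj_extensional [simp]: "parity_conj n A \<in> extensional (EPol n)"
  by (simp add: parity_conj_def)

lemma parity_conj_apply [simp]: "f \<in> EPol n \<Longrightarrow> parity_conj n A f = parity_inv (A (parity_inv f))"
  by (simp add: parity_conj_def)

lemma parity_conj_omult:
  "endo n A \<Longrightarrow> endo n B \<Longrightarrow> parity_conj n (omult n A B) = omult n (parity_conj n A) (parity_conj n B)"
  by (rule extensionalityI[of _ "EPol n"]) simp_all

lemma EENH_gens_cases:
  assumes "(A, d) \<in> EENH_gens n"
  obtains i where "i \<in> {1..n}" "A = opX n i" "d = 0"
  | i where "i \<in> {1..n}" "A = opWp n i" "d = 1"
  | i where "i \<in> {1..n}" "A = opWm n i" "d = 1"
  | r where "r \<in> {1..<n}" "A = opT n r" "d = 0"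
  using assms by (auto simp: EENH_gens_def)

lemma EENH_gens_endo: "(A, d) \<in> EENH_gens n \<Longrightarrow> endo n A"
  by (erule EENH_gens_cases) (simp_all add: endo_gens)

lemma EENH_endo: "A \<in> EENH n \<Longrightarrow> endo n A"
  unfolding EENH_def
  by (induction rule: generated_subalgebra.induct) (auto intro: EENH_gens_endo endo_ops)

lemma EENH_parity_endo: "A \<in> EENH_parity n p \<Longrightarrow> endo n A"
  unfolding EENH_parity_def graded_component_def mem_Collect_eq
  by (rule homogeneous_endo[OF EENH_gens_endo])

lemma bit_cases: "(b :: bit) = 0 \<or> b = 1"
  using bit_not_zero_iff by blast

lemma parity_conj_homogeneous:
  assumes "A \<in> EENH_parity n p" and "f \<in> EPol n"
  shows "parity_inv (A (parity_inv f)) = (if p = 1 then - A f else A f)"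
proof -
  have "homogeneous n (EENH_gens n) p A"
    using assms(1) by (simp add: EENH_parity_def graded_component_def)
  then show ?thesis
    using assms(2)
  proof (induction arbitrary: f)
    case (gen A d)
    from gen(1) show ?case
      by (rule EENH_gens_cases)
         (use gen(2) in \<open>simp_all add: parity_inv_eW_emult[of _ n] parity_inv_annih[of _ n]
            parity_inv_demazure\<close>)
  next
    case (mult d A e B)
    have A: "endo n A" and B: "endo n B"
      using mult(1,2) by (auto intro: homogeneous_endo[OF EENH_gens_endo])
    \<comment> \<open>\<epsilon>\<epsilon> = 1 is inserted between the two factors.\<close>
    have "parity_inv (omult n A B (parity_inv f)) =
        parity_inv (A (parity_inv (parity_inv (B (parity_inv f)))))"
      using mult.prems by simp
    also have "\<dots> = (if d + e = 1 then - omult n A B f else omult n A B f)"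
      using mult.prems A B bit_cases[of d] bit_cases[of e]
      by (auto simp: mult.IH endo_minus)
    finally show ?case .
  qed simp_all
qed

text \<open>In characteristic zero 2 can be cancelled, so an even part is recovered from the sum and
  the difference of the parts.\<close>

lemma add_self_cancel:
  fixes f g :: "'k::field_char_0 epol"
  assumes "f + f = g + g"
  shows "f = g"
proof (rule poly_mapping_eqI)
  fix I
  have "2 * Poly_Mapping.lookup f I = 2 * Poly_Mapping.lookup g I"
    using arg_cong[OF assms, of "\<lambda>h. Poly_Mapping.lookup h I"] by (simp only: lookup_add mult_2)
  then show "Poly_Mapping.lookup f I = Poly_Mapping.lookup g I"
    by simp
qed

lemma EENH_parts_unique:
  fixes c c' :: "bit \<Rightarrow> 'k::field_char_0 eop"
  assumes c: "\<And>p. c p \<in> EENH_parity n p" and c': "\<And>p. c' p \<in> EENH_parity n p"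
    and eq: "oadd n (c 0) (c 1) = oadd n (c' 0) (c' 1)"
  shows "c = c'"
proof
  fix p
  show "c p = c' p"
  proof (rule extensionalityI[of _ "EPol n"])
    fix f :: "'k epol"
    assume f: "f \<in> EPol n"
    have *: "c 0 g + c 1 g = c' 0 g + c' 1 g" if "g \<in> EPol n" for g
      using fun_cong[OF eq, of g] that by simp
    have 1: "c 0 f + c 1 f = c' 0 f + c' 1 f"
      using f by (rule *)
    have "parity_inv (c 0 (parity_inv f)) + parity_inv (c 1 (parity_inv f)) =
        parity_inv (c' 0 (parity_inv f)) + parity_inv (c' 1 (parity_inv f))"
      using *[of "parity_inv f"] f by (simp flip: parity_inv_linear(1))
    \<comment> \<open>Conjugation by \<epsilon> turns the sum of the parts into their
      difference.\<close>
    then have 2: "c 0 f - c 1 f = c' 0 f - c' 1 f"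
      using f by (simp add: parity_conj_homogeneous[OF c] parity_conj_homogeneous[OF c'])
    have "c 0 f + c 0 f = c' 0 f + c' 0 f"
      using arg_cong2[OF 1 2, of "(+)"] by simp
    then have "c 0 f = c' 0 f"
      by (rule add_self_cancel)
    with 1 show "c p f = c' p f"
      using bit_cases[of p] by auto
  qed (use c c' in \<open>auto intro: endo_extensional EENH_parity_endo\<close>)
qed

lemma EENH_parts_eq:
  assumes "\<And>p. c p \<in> EENH_parity n p" and "A = oadd n (c 0) (c 1)"
  shows "EENH_parts n A = c"
  unfolding EENH_parts_def
proof (rule the_equality)
  show "(\<forall>p. c p \<in> EENH_parity n p) \<and> A = oadd n (c 0) (c 1)"
    using assms by blast
  show "c' = c" if "(\<forall>p. c' p \<in> EENH_parity n p) \<and> A = oadd n (c' 0) (c' 1)" for c'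
    using that assms by (intro EENH_parts_unique[of c' n c]) simp_all
qed

lemma ozero_EENH_parity: "ozero n \<in> EENH_parity n p"
  by (simp add: EENH_parity_def graded_component_def homogeneous.zero)

lemma homogeneous_decomposition:
  assumes "A \<in> EENH_parity n p"
  shows "A = oadd n (if p = 0 then A else ozero n) (if p = 1 then A else ozero n)"
  using bit_cases[of p] EENH_parity_endo[OF assms]
  by (intro extensionalityI[of _ "EPol n"]) (auto simp: endo_extensional)

lemma EENH_parts_homogeneous:
  assumes "A \<in> EENH_parity n p"
  shows "EENH_parts n A = (\<lambda>q. if p = q then A else ozero n)"
proof (rule EENH_parts_eq)
  show "(if p = q then A else ozero n) \<in> EENH_parity n q" for q
    using assms by (auto simp: ozero_EENH_parity)
qed (rule homogeneous_decomposition[OF assms])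

lemma EENH_parts_spec:
  assumes "A \<in> EENH n"
  shows "EENH_parts n A p \<in> EENH_parity n p" and "A = oadd n (EENH_parts n A 0) (EENH_parts n A 1)"
proof -
  have "A \<in> homogeneous_sums n (EENH_gens n)"
    using generated_imp_homogeneous_sums[OF EENH_gens_endo] assms by (simp add: EENH_def)
  then have "\<exists>c. (\<forall>p. c p \<in> EENH_parity n p) \<and> A = oadd n (c 0) (c 1)"
  proof induction
    case (hom p A)
    then have A: "A \<in> EENH_parity n p"
      by (simp add: EENH_parity_def graded_component_def)
    show ?case
      by (rule exI[of _ "\<lambda>q. if p = q then A else ozero n"])
         (use A homogeneous_decomposition[OF A] in \<open>auto simp: ozero_EENH_parity\<close>)
  next
    case (add A B)
    then obtain c c' where c: "\<And>p. c p \<in> EENH_parity n p" "\<And>p. c' p \<in> EENH_parity n p"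
      "A = oadd n (c 0) (c 1)" "B = oadd n (c' 0) (c' 1)"
      by blast
    have "oadd n A B = oadd n (oadd n (c 0) (c' 0)) (oadd n (c 1) (c' 1))"
      by (rule extensionalityI[of _ "EPol n"]) (simp_all add: c)
    moreover have "oadd n (c p) (c' p) \<in> EENH_parity n p" for p
      using c(1,2)[of p] by (simp add: EENH_parity_def graded_component_def homogeneous.add)
    ultimately show ?case
      by (intro exI[of _ "\<lambda>p. oadd n (c p) (c' p)"]) simp
  qed
  then obtain c where c: "\<And>p. c p \<in> EENH_parity n p" "A = oadd n (c 0) (c 1)"
    by blast
  then have "EENH_parts n A = c"
    by (rule EENH_parts_eq)
  with c show "EENH_parts n A p \<in> EENH_parity n p" "A = oadd n (EENH_parts n A 0) (EENH_parts n A 1)"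
    by simp_all
qed

section \<open>The supercommutator with $\mathbb d_N$\<close>

definition sder :: "nat \<Rightarrow> nat \<Rightarrow> 'k::field_char_0 eop \<Rightarrow> 'k eop" where
  "sder n N A = (\<lambda>f\<in>EPol n. dder n N (A f) - parity_conj n A (dder n N f))"

lemma sder_extensional [simp]: "sder n N A \<in> extensional (EPol n)"
  by (simp add: sder_def)

lemma sder_apply [simp]:
  "f \<in> EPol n \<Longrightarrow> sder n N A f = dder n N (A f) - parity_inv (A (parity_inv (dder n N f)))"
  by (simp add: sder_def)

lemma ddN_apply:
  assumes "f \<in> EPol n"
  shows "ddN n N f = dder n N f"
  using assms by (simp add: ddN_def dder_def Pseq_eq_emb)

lemma ddN_odd: "(ddN n N :: 'k::field_char_0 eop) \<in> EENH_parity n 1"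
proof -
  have "homogeneous n (EENH_gens n) (0 + 1) (omult n (lmul n (Pseq n N i :: 'k epol)) (opWm n i))"
    if "i \<in> {1..n}" for i
  proof (rule homogeneous.mult)
    show "homogeneous n (EENH_gens n) 0 (lmul n (Pseq n N i :: 'k epol))"
      unfolding Pseq_eq_emb[OF that]
      by (rule homogeneous_lmul_emb) (use that in \<open>auto simp: EENH_gens_def\<close>)
    show "homogeneous n (EENH_gens n) 1 (opWm n i :: 'k eop)"
      by (rule homogeneous.gen) (use that in \<open>auto simp: EENH_gens_def\<close>)
  qed
  then show ?thesis
    unfolding EENH_parity_def graded_component_def ddN_def
    by (auto intro!: homogeneous_osum)
qed

lemma supercommutator_ddN:
  fixes h :: "'k::field_char_0 eop"
  assumes "h \<in> EENH n"
  shows "supercommutator n (ddN n N) h = sder n N h"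
proof (rule extensionalityI[of _ "EPol n"])
  define c where "c = EENH_parts n h"
  have c: "c p \<in> EENH_parity n p" for p
    unfolding c_def using assms by (rule EENH_parts_spec)
  note endo = EENH_parity_endo[OF c]
  have h: "h = oadd n (c 0) (c 1)"
    unfolding c_def using assms by (rule EENH_parts_spec)
  fix f :: "'k epol"
  assume f: "f \<in> EPol n"
  have U: "(UNIV :: (bit \<times> bit) set) = {(0, 0), (0, 1), (1, 0), (1, 1)}"
    using bit_cases by auto
  \<comment> \<open>As \<open>ddN\<close> is odd, the pairs with p = 0 drop out; the remaining sign
    is minus for q = 0 and plus for q = 1.\<close>
  have "supercommutator n (ddN n N) h f =
      dder n N (c 0 f) - c 0 (dder n N f) + (dder n N (c 1 f) + c 1 (dder n N f))"
    using f endo unfolding supercommutator_def U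
    by (simp add: EENH_parts_homogeneous[OF ddN_odd] ddN_apply endo_0[OF endo] single_uminus flip: c_def)
  \<comment> \<open>Conjugation turns c 0 + c 1 into c 0 - c 1, which absorbs both signs.\<close>
  also have "\<dots> = sder n N h f"
    using f endo parity_conj_homogeneous[OF c, of "dder n N f"]
    by (simp add: h)
  finally show "supercommutator n (ddN n N) h f = sder n N h f" .
qed (simp_all add: supercommutator_def)

lemma sder_oadd: "sder n N (oadd n A B) = oadd n (sder n N A) (sder n N B)"
  by (rule extensionalityI[of _ "EPol n"]) simp_all

lemma sder_oscale: "sder n N (oscale n c A) = oscale n c (sder n N A)"
  by (rule extensionalityI[of _ "EPol n"]) simp_all

text \<open>With D the derivation \<open>dder\<close> and A', B' the conjugates of A, B: add and
  subtract A' D B in D A B - A' B' D.\<close>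

lemma sder_omult:
  "endo n A \<Longrightarrow> endo n B \<Longrightarrow>
     sder n N (omult n A B) = oadd n (omult n (sder n N A) B) (omult n (parity_conj n A) (sder n N B))"
  by (rule extensionalityI[of _ "EPol n"]) (simp_all add: endo_diff)

lemma sder_oone: "sder n N (oone n) = ozero n"
  by (rule extensionalityI[of _ "EPol n"]) simp_all

lemma sder_opX: "i \<in> {1..n} \<Longrightarrow> sder n N (opX n i) = ozero n"
  by (rule extensionalityI[of _ "EPol n"]) simp_all

lemma sder_opT: "r \<in> {1..<n} \<Longrightarrow> sder n N (opT n r) = ozero n"
  by (rule extensionalityI[of _ "EPol n"]) (simp_all add: parity_inv_demazure dder_demazure)

lemma sder_opWp: "i \<in> {1..n} \<Longrightarrow> sder n N (opWp n i) = lmul n (emb (dpol n N i))"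
  by (rule extensionalityI[of _ "EPol n"]) (simp_all add: dder_eW_emult parity_inv_eW_emult[of _ n])

section \<open>The differential\<close>

lemma ENH_deg_parity:
  assumes "A \<in> ENH_deg n k"
  shows "A \<in> EENH_parity n (of_nat k)"
proof -
  have "homogeneous n (ENH_gens n) k A"
    using assms by (simp add: ENH_deg_def graded_component_def)
  then have "homogeneous n (EENH_gens n) (of_nat k) A"
  proof induction
    case (gen A d)
    then have "(A, of_nat d) \<in> EENH_gens n"
      by (auto simp: ENH_gens_def EENH_gens_def)
    then show ?case by (rule homogeneous.gen)
  next
    case (mult d A e B)
    from homogeneous.mult[OF mult.IH] show ?case
      by (simp only: of_nat_add)
  qed (auto intro: homogeneous.intros)
  then show ?thesis
    by (simp add: EENH_parity_def graded_component_def)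
qed

lemma parity_conj_ENH_deg:
  assumes "A \<in> ENH_deg n k"
  shows "parity_conj n A = oscale n ((- 1) ^ k) A"
proof (rule extensionalityI[of _ "EPol n"])
  fix f :: "'a epol"
  assume f: "f \<in> EPol n"
  have "(of_nat k = (1 :: bit)) = odd k"
    by (induction k) auto
  then show "parity_conj n A f = oscale n ((- 1) ^ k) A f"
    using f parity_conj_homogeneous[OF ENH_deg_parity[OF assms] f]
    by (cases "even k") (simp_all add: single_uminus)
qed simp_all

lemma ENH_gens_cases:
  assumes "(A, d) \<in> ENH_gens n"
  obtains i where "i \<in> {1..n}" "A = opX n i" "d = 0"
  | i where "i \<in> {1..n}" "A = opWp n i" "d = 1"
  | r where "r \<in> {1..<n}" "A = opT n r" "d = 0"
  using assms by (auto simp: ENH_gens_def)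

lemma ENH_endo: "A \<in> ENH n \<Longrightarrow> endo n A"
  using ENH_subset_EENH EENH_endo by blast

lemma ENH_deg_subset: "A \<in> ENH_deg n k \<Longrightarrow> A \<in> ENH n"
  using homogeneous_imp_generated by (auto simp: ENH_deg_def graded_component_def ENH_def)

lemma ENH_deg_ops:
  "oone n \<in> ENH_deg n 0" "ozero n \<in> ENH_deg n k"
  "A \<in> ENH_deg n k \<Longrightarrow> oscale n c A \<in> ENH_deg n k"
  "A \<in> ENH_deg n k \<Longrightarrow> B \<in> ENH_deg n k \<Longrightarrow> oadd n A B \<in> ENH_deg n k"
  "A \<in> ENH_deg n k \<Longrightarrow> B \<in> ENH_deg n l \<Longrightarrow> omult n A B \<in> ENH_deg n (k + l)"
  by (simp_all add: ENH_deg_def graded_component_def homogeneous.intros)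

lemma ENH_deg_gens:
  "i \<in> {1..n} \<Longrightarrow> opX n i \<in> ENH_deg n 0" "i \<in> {1..n} \<Longrightarrow> opWp n i \<in> ENH_deg n 1"
  "r \<in> {1..<n} \<Longrightarrow> opT n r \<in> ENH_deg n 0"
  unfolding ENH_deg_def graded_component_def mem_Collect_eq
  by (rule homogeneous.gen; auto simp: ENH_gens_def)+

lemma lmul_emb_ENH: "p \<in> Pol n \<Longrightarrow> lmul n (emb p) \<in> ENH n"
  unfolding ENH_def
  by (rule homogeneous_imp_generated[of _ _ 0], rule homogeneous_lmul_emb)
     (auto simp: ENH_gens_def)

lemma ENH_ops:
  "A \<in> ENH n \<Longrightarrow> oscale n c A \<in> ENH n" "A \<in> ENH n \<Longrightarrow> B \<in> ENH n \<Longrightarrow> oadd n A B \<in> ENH n"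
  "A \<in> ENH n \<Longrightarrow> B \<in> ENH n \<Longrightarrow> omult n A B \<in> ENH n"
  unfolding ENH_def by (auto intro: generated_subalgebra.intros)

text \<open>The product rule for \<open>sder\<close> involves the conjugate of the left factor, so
  closure under conjugation is carried through the same induction.\<close>

lemma sder_parity_conj_ENH:
  assumes "A \<in> ENH n"
  shows "sder n N A \<in> ENH n \<and> parity_conj n A \<in> ENH n"
  using assms unfolding ENH_def
proof (induction rule: generated_subalgebra.induct)
  case (gen A)
  then obtain d where d: "(A, d) \<in> ENH_gens n" by auto
  then have A: "A \<in> ENH_deg n d"
    by (simp add: ENH_deg_def graded_component_def homogeneous.gen)
  then have "parity_conj n A \<in> ENH n"
    by (simp add: parity_conj_ENH_deg ENH_deg_subset ENH_ops)
  moreover have "sder n N A \<in> ENH n"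
    using d by (rule ENH_gens_cases)
      (simp_all add: sder_opX sder_opT sder_opWp lmul_emb_ENH ENH_deg_subset[OF ENH_deg_ops(2)])
  ultimately show ?case
    by (simp add: ENH_def)
next
  case one
  show ?case
    unfolding ENH_def[symmetric] sder_oone parity_conj_ENH_deg[OF ENH_deg_ops(1)]
    by (intro conjI ENH_ops ENH_deg_subset[OF ENH_deg_ops(1)] ENH_deg_subset[OF ENH_deg_ops(2)])
next
  case (scale A c)
  have "parity_conj n (oscale n c A) = oscale n c (parity_conj n A)"
    by (rule extensionalityI[of _ "EPol n"]) simp_all
  with scale show ?case
    by (simp add: sder_oscale generated_subalgebra.scale)
next
  case (add A B)
  have "parity_conj n (oadd n A B) = oadd n (parity_conj n A) (parity_conj n B)"
    by (rule extensionalityI[of _ "EPol n"]) simp_all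
  with add show ?case
    by (simp add: sder_oadd generated_subalgebra.add)
next
  case (mult A B)
  then have "endo n A" "endo n B"
    using ENH_endo unfolding ENH_def by blast+
  with mult show ?case
    by (simp add: sder_omult parity_conj_omult generated_subalgebra.add generated_subalgebra.mult)
qed

lemma sder_differential:
  assumes "n \<ge> 1"
  shows "is_ENH_differential n N (restrict (sder n N :: 'k::field_char_0 eop \<Rightarrow> _) (ENH n))"
proof -
  have "sder n N (opWp n 1) = lmul n (emb (pX 1 ^ N) :: 'k epol)"
    using assms sder_opWp[of 1 n N] by (simp add: dpol_1)
  moreover have "sder n N (omult n A B) =
      oadd n (omult n (sder n N A) B) (oscale n ((- 1) ^ k) (omult n A (sder n N B)))"
    if "A \<in> ENH_deg n k" "B \<in> ENH_deg n l" for A B :: "'k eop" and k l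
  proof -
    have "endo n A" "endo n B"
      using that ENH_deg_subset ENH_endo by blast+
    then have "sder n N (omult n A B) =
        oadd n (omult n (sder n N A) B) (omult n (oscale n ((- 1) ^ k) A) (sder n N B))"
      using that(1) by (simp add: sder_omult parity_conj_ENH_deg)
    also have "omult n (oscale n ((- 1) ^ k) A) (sder n N B) = oscale n ((- 1) ^ k) (omult n A (sder n N B))"
      by (rule extensionalityI[of _ "EPol n"]) (use \<open>endo n B\<close> in simp_all)
    finally show ?thesis .
  qed
  ultimately show ?thesis
    using assms unfolding is_ENH_differential_def
    by (auto simp: sder_parity_conj_ENH ENH_ops ENH_deg_subset ENH_deg_gens[THEN ENH_deg_subset]
        sder_oadd sder_oscale sder_opX sder_opT simp del: op_apply)
qed

section \<open>Uniqueness of the differential\<close>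

text \<open>
  The relation \<open>\<omega>\<^bsub>r+1\<^esub> = \<omega>\<^sub>r T\<^sub>r - T\<^sub>r \<omega>\<^sub>r - (X\<^sub>r - X\<^bsub>r+1\<^esub>) T\<^sub>r \<omega>\<^sub>r T\<^sub>r\<close>, which shows that a
  differential is determined by its value at \<open>\<omega>\<^sub>1\<close>.
\<close>

lemma opWp_Suc:
  assumes r: "r \<in> {1..<n}"
  shows "opWp n (Suc r) = oadd n (omult n (opWp n r) (opT n r))
    (oscale n (- 1) (oadd n (omult n (opT n r) (opWp n r))
       (omult n (oadd n (opX n r) (oscale n (- 1) (opX n (Suc r))))
         (omult n (opT n r) (omult n (opWp n r) (opT n r))))))"
proof (rule extensionalityI[of _ "EPol n"])
  fix f :: "'a epol"
  assume f: "f \<in> EPol n"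
  \<comment> \<open>T_r \<omega>_r T_r = - \<omega>_(r+1) T_r, because T_r T_r = 0 and s_r T_r =
    T_r.\<close>
  have "demazure n r (eW r \<star> demazure n r f) = - (eW (Suc r) \<star> demazure n r f)"
    using r f by (simp add: demazure_eW_emult demazure_demazure swap_epol_demazure)
  moreover have "emb (pX r) \<star> g - emb (pX (Suc r)) \<star> g = emb (xdiff r) \<star> g" for g :: "'a epol"
    by (simp add: xdiff_def emb_diff_emult)
  \<comment> \<open>The difference \<omega>_r T_r - T_r \<omega>_r is \<omega>_(r+1) s_r; this term
    completes it to \<omega>_(r+1).\<close>
  moreover have "emb (xdiff r) \<star> (eW (Suc r) \<star> demazure n r f) = eW (Suc r) \<star> f - eW (Suc r) \<star> swap_epol r f"
    using r f by (simp add: xdiff_demazure flip: eW_emult_emb_emult)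
  ultimately show "opWp n (Suc r) f = oadd n (omult n (opWp n r) (opT n r))
    (oscale n (- 1) (oadd n (omult n (opT n r) (opWp n r))
       (omult n (oadd n (opX n r) (oscale n (- 1) (opX n (Suc r))))
         (omult n (opT n r) (omult n (opWp n r) (opT n r)))))) f"
    using r f by (simp add: demazure_eW_emult single_uminus)
qed simp_all

lemma differential_ozero:
  assumes "is_ENH_differential n N d"
  shows "d (ozero n) = ozero n"
proof -
  have "d (oscale n 0 (ozero n)) = oscale n 0 (d (ozero n))"
    using assms ENH_deg_subset[OF ENH_deg_ops(2)] unfolding is_ENH_differential_def by blast
  then show ?thesis
    by (simp add: oscale_0)
qed

text \<open>The Leibniz rule for 1 * 1 reads d(1) = d(1) + d(1).\<close>

lemma differential_oone:
  fixes d :: "'k::field_char_0 eop \<Rightarrow> 'k eop"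
  assumes d: "is_ENH_differential n N d"
  shows "d (oone n) = ozero n"
proof -
  have "oone n \<in> ENH n"
    using ENH_deg_subset[OF ENH_deg_ops(1)] .
  then have "d (oone n) \<in> ENH n"
    using d unfolding is_ENH_differential_def by blast
  then have endo: "endo n (d (oone n))"
    by (rule ENH_endo)
  have leibniz: "d (omult n (oone n) (oone n)) =
      oadd n (omult n (d (oone n)) (oone n)) (oscale n ((- 1) ^ 0) (omult n (oone n) (d (oone n))))"
    using d ENH_deg_ops(1)[of n] unfolding is_ENH_differential_def by blast
  have one: "omult n (oone n) (oone n) = oone n"
    by (rule extensionalityI[of _ "EPol n"]) simp_all
  have eq: "d (oone n) =
      oadd n (omult n (d (oone n)) (oone n)) (oscale n ((- 1) ^ 0) (omult n (oone n) (d (oone n))))"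
    using leibniz unfolding one .
  show ?thesis
  proof (rule extensionalityI[of _ "EPol n"])
    fix f :: "'k epol"
    assume "f \<in> EPol n"
    with fun_cong[OF eq, of f] endo show "d (oone n) f = ozero n f"
      by simp
  qed (use endo in \<open>simp_all add: endo_extensional\<close>)
qed

lemma differential_unique:
  assumes n: "n \<ge> 1" and d: "is_ENH_differential n N d" and d': "is_ENH_differential n N d'"
  shows "d = (d' :: 'k::field_char_0 eop \<Rightarrow> 'k eop)"
proof -
  \<comment> \<open>The Leibniz rule binds homogeneous operators only, so agreement is recorded
    together with a degree; additivity extends it to sums at the end.\<close>
  define E where "E k = {A \<in> ENH_deg n k. d A = d' A}" for k
  note D = d[unfolded is_ENH_differential_def] and D' = d'[unfolded is_ENH_differential_def]
  have ENH: "A \<in> ENH n" if "A \<in> E k" for A k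
    using that ENH_deg_subset by (auto simp: E_def)
  have add: "oadd n A B \<in> E k" if "A \<in> E k" "B \<in> E k" for A B k
    using that that[THEN ENH] D D' by (simp add: E_def ENH_deg_ops)
  have scale: "oscale n c A \<in> E k" if "A \<in> E k" for A c k
    using that that[THEN ENH] D D' by (simp add: E_def ENH_deg_ops)
  have mult: "omult n A B \<in> E (k + l)" if "A \<in> E k" "B \<in> E l" for A B k l
  proof -
    have "d (omult n A B) = oadd n (omult n (d A) B) (oscale n ((- 1) ^ k) (omult n A (d B)))"
      "d' (omult n A B) = oadd n (omult n (d' A) B) (oscale n ((- 1) ^ k) (omult n A (d' B)))"
      using that D D' by (auto simp: E_def)
    with that show ?thesis
      by (simp add: E_def ENH_deg_ops)
  qed
  have X: "opX n i \<in> E 0" if "i \<in> {1..n}" for i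
    using that D D' by (simp add: E_def ENH_deg_gens)
  have T: "opT n r \<in> E 0" if "r \<in> {1..<n}" for r
    using that D D' by (simp add: E_def ENH_deg_gens)
  have W: "opWp n i \<in> E 1" if "i \<in> {1..n}" for i
    using that
  proof (induction i)
    case (Suc r)
    show ?case
    proof (cases "r = 0")
      case True
      then show ?thesis
        using D D' ENH_deg_gens(2)[of 1 n] n by (simp add: E_def)
    next
      case False
      with Suc have r: "r \<in> {1..<n}" and Wr: "opWp n r \<in> E 1"
        by auto
      have WT: "omult n (opWp n r) (opT n r) \<in> E 1" and TW: "omult n (opT n r) (opWp n r) \<in> E 1"
        using mult[OF Wr T[OF r]] mult[OF T[OF r] Wr] by simp_all
      have TWT: "omult n (opT n r) (omult n (opWp n r) (opT n r)) \<in> E 1"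
        using mult[OF T[OF r] WT] by simp
      have XX: "oadd n (opX n r) (oscale n (- 1) (opX n (Suc r))) \<in> E 0"
        using r by (intro add scale X) auto
      show ?thesis
        unfolding opWp_Suc[OF r]
        using mult[OF XX TWT] by (intro add scale WT TW) simp
    qed
  qed simp
  have one: "oone n \<in> E 0" and zero: "ozero n \<in> E k" for k
    by (simp_all add: E_def ENH_deg_ops differential_oone[OF d] differential_oone[OF d']
        differential_ozero[OF d] differential_ozero[OF d'])
  have hom: "A \<in> E k" if "homogeneous n (ENH_gens n) k A" for A k
    using that
  proof induction
    case (gen A d)
    then show ?case
      by (rule ENH_gens_cases) (simp_all add: X T W[unfolded One_nat_def])
  qed (simp_all add: one zero scale add mult)
  have "d A = d' A" if "A \<in> ENH n" for A
  proof -
    have "A \<in> homogeneous_sums n (ENH_gens n)"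
    proof (rule generated_imp_homogeneous_sums)
      show "endo n A" if "(A, d) \<in> ENH_gens n" for A d
        using that by (rule ENH_gens_cases) (simp_all add: endo_gens)
    qed (use that in \<open>simp add: ENH_def\<close>)
    then have "A \<in> ENH n \<and> d A = d' A"
    proof induction
      case (hom k A)
      with \<open>\<And>A k. homogeneous n (ENH_gens n) k A \<Longrightarrow> A \<in> E k\<close> show ?case
        by (auto simp: E_def intro: ENH_deg_subset)
    next
      case (add A B)
      then show ?case
        using D D' by (simp add: ENH_ops)
    qed
    then show ?thesis ..
  qed
  \<comment> \<open>Both maps are \<open>undefined\<close> outside \<open>ENH n\<close>, so
    agreement on \<open>ENH n\<close> is equality.\<close>
  then show ?thesis
    using D D' by (intro PiE_ext[of d "ENH n" "\<lambda>_. ENH n" d']) auto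
qed

theorem proposition3p18:
  fixes n N :: nat and h :: "'k::field_char_0 eop"
  assumes "n \<ge> 1" and "h \<in> ENH n"
  shows "dN n N h = supercommutator n (ddN n N) h"
proof -
  have "dN n N = restrict (sder n N :: 'k eop \<Rightarrow> _) (ENH n)"
    unfolding dN_def
  proof (rule the_equality)
    show diff: "is_ENH_differential n N (restrict (sder n N :: 'k eop \<Rightarrow> _) (ENH n))"
      using assms(1) by (rule sder_differential)
    show "d = restrict (sder n N) (ENH n)" if "is_ENH_differential n N d" for d :: "'k eop \<Rightarrow> _"
      using assms(1) that diff by (rule differential_unique)
  qed
  moreover have "h \<in> EENH n"
    using assms(2) ENH_subset_EENH by blast
  ultimately show ?thesis
    using assms(2) by (simp add: supercommutator_ddN)
qed

end
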